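(* Assume $c \ge 0$ a.e. in $\Omega$ and $c - \operatorname{div} b \ge \lambda > 0$ a.e. in $\Omega$ for a constant $\lambda$. Let $(u,q)\in H^1_0\times D$ be the exact solution of problem (P2) with data $f\in L^2$, and let $(\tilde u,\tilde q)\in H^1_0\times D$ be arbitrary. Then $$\|u-\tilde u\|_c^2 + \|\nabla(u-\tilde u)\|_A^2 + \|q-\tilde q + b(u-\tilde u)\|_{A^{-1}}^2 + \|\operatorname{div}(q-\tilde q)\|_{(c-\operatorname{div} b)^{-1}}^2 = \mathcal M_2(\tilde u,\tilde q),$$ where $$\mathcal M_2(\tilde u,\tilde q) := \|f - (c-\operatorname{div} b)\tilde u + \operatorname{div}\tilde q\|_{(c-\operatorname{div} b)^{-1}}^2 + \|\tilde q - A\nabla\tilde u + b\tilde u\|_{A^{-1}}^2 .$$ Moreover, if $f\neq 0$, then, writing $\|(x,y)\|_2^2 := \|x\|_c^2 + \|\nabla x\|_A^2 + \|y + b x\|_{A^{-1}}^2 + \|\operatorname{div} y\|_{(c-\operatorname{div} b)^{-1}}^2$, $$\frac{\|(u,q)-(\tilde u,\tilde q)\|_2^2}{\|(u,q)\|_2^2} = \frac{\mathcal M_2(\tilde u,\tilde q)}{\|f\|_{(c-\operatorname{div} b)^{-1}}^2}.$$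
   Context: $\Omega \subset \mathbb R^d$ ($d\ge1$) is an arbitrary open domain (bounded or unbounded). All function spaces are over $\mathbb C$. $L^2 = L^2(\Omega)$ (scalar or vector valued) has inner product $(x,y) = \int_\Omega x\cdot\bar y$ and norm $\|\cdot\|$. For a real scalar or Hermitian-matrix valued weight $\gamma \in L^\infty(\Omega)$ with $\gamma\ge 0$, $\|v\|_\gamma^2 := (\gamma v, v)$. $H^1 = \{\varphi\in L^2 : \nabla\varphi\in L^2\}$, $D = \{\psi \in L^2(\Omega;\mathbb C^d) : \operatorname{div}\psi \in L^2\}$, and $H^1_0$ is the closure of $C_c^\infty(\Omega)$ in $H^1$. Coefficients: $A \in L^\infty(\Omega;\mathbb C^{d\times d})$ is pointwise Hermitian and satisfies $\alpha\|\varphi\|^2 \le (A\varphi,\varphi) \le \beta\|\varphi\|^2$ for all $\varphi\in L^2(\Omega;\mathbb C^d)$ with constants $0<\alpha\le\beta$; $b\in L^\infty(\Omega;\mathbb R^d)$ is real with distributional divergence $\operatorname{div} b \in L^\infty(\Omega)$; $c\in L^\infty(\Omega)$ is real valued; $f\in L^2$. Problem (P2): find $(u,q)\in H^1_0\times D$ with $q = A\nabla u - b\,u$ and $-\operatorname{div} q + (c-\operatorname{div} b)u = f$ a.e. in $\Omega$. *)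

theory Defs
  imports "HOL-Analysis.Analysis"
begin

definition pderiv_i :: "'n::finite \<Rightarrow> (real^'n \<Rightarrow> 'b::real_normed_vector) \<Rightarrow> real^'n \<Rightarrow> 'b" where
  "pderiv_i i f x = frechet_derivative f (at x) (axis i 1)"

coinductive smooth_fun :: "(real^'n::finite \<Rightarrow> 'b::real_normed_vector) \<Rightarrow> bool" where
  "(\<forall>x. f differentiable (at x)) \<Longrightarrow> (\<forall>i. smooth_fun (pderiv_i i f)) \<Longrightarrow> smooth_fun f"

definition test_fun :: "(real^'n::finite) set \<Rightarrow> (real^'n \<Rightarrow> complex) set" where
  "test_fun \<Omega> = {\<phi>. smooth_fun \<phi> \<and> compact (closure {x. \<phi> x \<noteq> 0}) \<and> closure {x. \<phi> x \<noteq> 0} \<subseteq> \<Omega>}"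

definition L2 :: "(real^'n::finite) set \<Rightarrow> (real^'n \<Rightarrow> complex) \<Rightarrow> bool" where
  "L2 \<Omega> v \<longleftrightarrow> v \<in> borel_measurable (lebesgue_on \<Omega>) \<and>
     integrable (lebesgue_on \<Omega>) (\<lambda>x. (cmod (v x))\<^sup>2)"

definition L2v :: "(real^'n::finite) set \<Rightarrow> (real^'n \<Rightarrow> complex^'n) \<Rightarrow> bool" where
  "L2v \<Omega> v \<longleftrightarrow> (\<forall>i. L2 \<Omega> (\<lambda>x. v x $ i))"

definition Linf :: "(real^'n::finite) set \<Rightarrow> (real^'n \<Rightarrow> 'b::{real_normed_vector,second_countable_topology}) \<Rightarrow> bool" where
  "Linf \<Omega> g \<longleftrightarrow> g \<in> borel_measurable (lebesgue_on \<Omega>) \<and>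
     (\<exists>C. AE x in lebesgue_on \<Omega>. norm (g x) \<le> C)"

definition cinner :: "complex^'n::finite \<Rightarrow> complex^'n \<Rightarrow> complex" where
  "cinner v w = (\<Sum>i\<in>UNIV. v $ i * cnj (w $ i))"

definition weak_grad :: "(real^'n::finite) set \<Rightarrow> (real^'n \<Rightarrow> complex) \<Rightarrow> (real^'n \<Rightarrow> complex^'n) \<Rightarrow> bool" where
  "weak_grad \<Omega> u g \<longleftrightarrow> (\<forall>\<phi>\<in>test_fun \<Omega>. \<forall>i.
      integrable (lebesgue_on \<Omega>) (\<lambda>x. u x * pderiv_i i \<phi> x) \<and>
      integrable (lebesgue_on \<Omega>) (\<lambda>x. g x $ i * \<phi> x) \<and>
      (\<integral>x. u x * pderiv_i i \<phi> x \<partial>lebesgue_on \<Omega>) = - (\<integral>x. g x $ i * \<phi> x \<partial>lebesgue_on \<Omega>))"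

definition weak_div :: "(real^'n::finite) set \<Rightarrow> (real^'n \<Rightarrow> complex^'n) \<Rightarrow> (real^'n \<Rightarrow> complex) \<Rightarrow> bool" where
  "weak_div \<Omega> q w \<longleftrightarrow> (\<forall>\<phi>\<in>test_fun \<Omega>.
      integrable (lebesgue_on \<Omega>) (\<lambda>x. \<Sum>i\<in>UNIV. q x $ i * pderiv_i i \<phi> x) \<and>
      integrable (lebesgue_on \<Omega>) (\<lambda>x. w x * \<phi> x) \<and>
      (\<integral>x. (\<Sum>i\<in>UNIV. q x $ i * pderiv_i i \<phi> x) \<partial>lebesgue_on \<Omega>) = - (\<integral>x. w x * \<phi> x \<partial>lebesgue_on \<Omega>))"

(* the weak gradient / divergence (unique up to null sets; any representative) *)
definition wgrad :: "(real^'n::finite) set \<Rightarrow> (real^'n \<Rightarrow> complex) \<Rightarrow> real^'n \<Rightarrow> complex^'n" where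
  "wgrad \<Omega> u = (SOME g. weak_grad \<Omega> u g)"

definition wdiv :: "(real^'n::finite) set \<Rightarrow> (real^'n \<Rightarrow> complex^'n) \<Rightarrow> real^'n \<Rightarrow> complex" where
  "wdiv \<Omega> q = (SOME w. weak_div \<Omega> q w)"

definition H1 :: "(real^'n::finite) set \<Rightarrow> (real^'n \<Rightarrow> complex) set" where
  "H1 \<Omega> = {u. L2 \<Omega> u \<and> (\<exists>g. L2v \<Omega> g \<and> weak_grad \<Omega> u g)}"

definition Hdiv :: "(real^'n::finite) set \<Rightarrow> (real^'n \<Rightarrow> complex^'n) set" where
  "Hdiv \<Omega> = {q. L2v \<Omega> q \<and> (\<exists>w. L2 \<Omega> w \<and> weak_div \<Omega> q w)}"

definition cgrad :: "(real^'n::finite \<Rightarrow> complex) \<Rightarrow> real^'n \<Rightarrow> complex^'n" where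
  "cgrad \<phi> x = (\<chi> i. pderiv_i i \<phi> x)"

definition H10 :: "(real^'n::finite) set \<Rightarrow> (real^'n \<Rightarrow> complex) set" where
  "H10 \<Omega> = {u. u \<in> H1 \<Omega> \<and> (\<exists>\<phi>. (\<forall>k. \<phi> k \<in> test_fun \<Omega>) \<and>
      (\<lambda>k. (\<integral>x. (cmod (u x - \<phi> k x))\<^sup>2 \<partial>lebesgue_on \<Omega>)
         + (\<integral>x. (norm (wgrad \<Omega> u x - cgrad (\<phi> k) x))\<^sup>2 \<partial>lebesgue_on \<Omega>)) \<longlonglongrightarrow> 0)}"

definition wnorm2 :: "(real^'n::finite) set \<Rightarrow> (real^'n \<Rightarrow> real) \<Rightarrow> (real^'n \<Rightarrow> complex) \<Rightarrow> real" where
  "wnorm2 \<Omega> \<gamma> v = (\<integral>x. \<gamma> x * (cmod (v x))\<^sup>2 \<partial>lebesgue_on \<Omega>)"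

definition wnorm2m :: "(real^'n::finite) set \<Rightarrow> (real^'n \<Rightarrow> complex^'n^'n) \<Rightarrow> (real^'n \<Rightarrow> complex^'n) \<Rightarrow> real" where
  "wnorm2m \<Omega> M v = Re (\<integral>x. cinner (M x *v v x) (v x) \<partial>lebesgue_on \<Omega>)"

definition cvec :: "real^'n::finite \<Rightarrow> complex^'n" where
  "cvec v = (\<chi> i. complex_of_real (v $ i))"

definition norm2_sq :: "(real^'n::finite) set \<Rightarrow> (real^'n \<Rightarrow> complex^'n^'n) \<Rightarrow> (real^'n \<Rightarrow> real^'n)
    \<Rightarrow> (real^'n \<Rightarrow> real) \<Rightarrow> (real^'n \<Rightarrow> real)
    \<Rightarrow> (real^'n \<Rightarrow> complex) \<Rightarrow> (real^'n \<Rightarrow> complex^'n) \<Rightarrow> real" where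
  "norm2_sq \<Omega> A b c divb x y =
     wnorm2 \<Omega> c x + wnorm2m \<Omega> A (wgrad \<Omega> x)
     + wnorm2m \<Omega> (\<lambda>t. matrix_inv (A t)) (\<lambda>t. y t + x t *s cvec (b t))
     + wnorm2 \<Omega> (\<lambda>t. inverse (c t - divb t)) (wdiv \<Omega> y)"

definition M2 :: "(real^'n::finite) set \<Rightarrow> (real^'n \<Rightarrow> complex^'n^'n) \<Rightarrow> (real^'n \<Rightarrow> real^'n)
    \<Rightarrow> (real^'n \<Rightarrow> real) \<Rightarrow> (real^'n \<Rightarrow> real) \<Rightarrow> (real^'n \<Rightarrow> complex)
    \<Rightarrow> (real^'n \<Rightarrow> complex) \<Rightarrow> (real^'n \<Rightarrow> complex^'n) \<Rightarrow> real" where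
  "M2 \<Omega> A b c divb f ut qt =
     wnorm2 \<Omega> (\<lambda>t. inverse (c t - divb t))
        (\<lambda>t. f t - complex_of_real (c t - divb t) * ut t + wdiv \<Omega> qt t)
     + wnorm2m \<Omega> (\<lambda>t. matrix_inv (A t))
        (\<lambda>t. qt t - A t *v wgrad \<Omega> ut t + ut t *s cvec (b t))"

end

theory Submission
  imports Defs
begin

text \<open>
  Let \<open>e\<close> and \<open>p\<close> be the errors in the two variables and \<open>k = c - div b\<close>. By the equations of
  (P2) the residuals in the majorant are \<open>k e - div p\<close> and \<open>A grad e - (p + b e)\<close>. Expanding their
  weighted squares produces the error norm together with the cross terms
  \<open>2 Re (div p, e) + 2 Re (p, grad e) + 2 Re (b e, grad e) + (e div b, e)\<close>, which vanish: the
  first two by Green's formula for \<open>H10\<close> and \<open>Hdiv\<close>, the last two because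
  \<open>2 Re (b e, grad e)\<close> is \<open>b\<close> tested against the gradient of \<open>\<bar>e\<bar>\<^sup>2\<close>. The same identity
  with zero approximation gives the norm of the exact solution.
\<close>

section \<open>Smooth functions and test functions\<close>

text \<open>\<open>wgrad\<close> and \<open>wdiv\<close> are Hilbert choices among all weak
  derivatives. A choice is not additive, and it need not be the square integrable witness that
  \<open>H1\<close> or \<open>Hdiv\<close> provides, so little can be computed before weak
  derivatives are known to be unique almost everywhere. This is the reason for proving the
  fundamental lemma of the calculus of variations, and with it the existence of enough test
  functions for the coinductive \<open>smooth_fun\<close>. The integral arguments then carry
  explicit representatives and return to the chosen ones only at the end.

  Two more gaps separate the hypotheses from the algebra. The lower bound on \<open>A\<close> is
  given for integrals, whereas the expansion of the flux residual inverts \<open>A x\<close> at a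
  single point. And \<open>b\<close> is only bounded with bounded divergence, so products containing
  \<open>b\<close> cannot be differentiated; the product rule is applied to smooth approximations of
  \<open>e\<close> alone, and the rest is a limit in square mean.\<close>

lemma pderiv_i_eq: "(f has_derivative f') (at x) \<Longrightarrow> pderiv_i i f x = f' (axis i 1)"
  unfolding pderiv_i_def by (metis frechet_derivative_at)

lemma smooth_fun_differentiable: "smooth_fun f \<Longrightarrow> f differentiable (at x)"
  by (erule smooth_fun.cases) blast

lemma smooth_fun_pderiv: "smooth_fun f \<Longrightarrow> smooth_fun (pderiv_i i f)"
  by (erule smooth_fun.cases) blast

lemma smooth_fun_continuous: "smooth_fun f \<Longrightarrow> continuous_on S f"
  by (meson differentiable_imp_continuous_within continuous_at_imp_continuous_on smooth_fun_differentiable)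

section \<open>A smooth function on the line that is flat at zero\<close>

text \<open>\<open>flat 0\<close> is the classical function \<open>exp (- (1 / t))\<close> extended
  by zero. The powers of \<open>1 / t\<close> are carried along because differentiation produces
  such factors; with them the linear span of the family is closed under derivatives.\<close>

definition flat :: "nat \<Rightarrow> real \<Rightarrow> real" where
  "flat n t = (if t > 0 then (1 / t) ^ n * exp (- (1 / t)) else 0)"

text \<open>With \<open>s = 1 / t\<close> the limit from the right is the decay of
  \<open>s ^ n / exp s\<close> at infinity; from the left the function is constantly zero.\<close>

lemma flat_tendsto_0: "(flat n \<longlongrightarrow> 0) (at 0)"
proof -
  have "((\<lambda>x::real. x ^ n / exp x) \<longlongrightarrow> 0) at_top"
    by (rule tendsto_power_div_exp_0)
  then have "((\<lambda>t::real. (inverse t) ^ n / exp (inverse t)) \<longlongrightarrow> 0) (at_right 0)"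
    by (rule filterlim_compose) (rule filterlim_inverse_at_top_right)
  then have R: "(flat n \<longlongrightarrow> 0) (at_right 0)"
    by (rule Lim_transform_eventually)
       (auto simp: eventually_at_filter flat_def exp_minus divide_inverse)
  have L: "(flat n \<longlongrightarrow> 0) (at_left 0)"
    by (rule tendsto_eventually) (auto simp: eventually_at_filter flat_def)
  show ?thesis using filterlim_split_at[OF L R] by simp
qed

lemma flat_deriv:
  "(flat n has_real_derivative flat (n + 2) t - real n * flat (n + 1) t) (at t)"
proof -
  consider "t > 0" | "t = 0" | "t < 0" by linarith
  then show ?thesis
  proof cases
    case 1
    have "((\<lambda>t. (1 / t) ^ n * exp (- (1 / t))) has_real_derivative
           flat (n + 2) t - real n * flat (n + 1) t) (at t)"
    proof -
      have i: "((\<lambda>t. 1 / t) has_real_derivative - (1 / t)\<^sup>2) (at t)"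
        using 1 by (auto intro!: derivative_eq_intros simp: power2_eq_square)
      have p: "((\<lambda>t. (1 / t) ^ n) has_real_derivative real n * (- (1 / t)\<^sup>2) * (1 / t) ^ (n - 1)) (at t)"
        using DERIV_power[OF i, of n] by (simp add: mult_ac)
      have e: "((\<lambda>t. exp (- (1 / t))) has_real_derivative exp (- (1 / t)) * (1 / t)\<^sup>2) (at t)"
        using DERIV_fun_exp[OF DERIV_minus[OF i]] by simp
      \<comment> \<open>Here \<open>r\<close> stands for \<open>1 / t\<close> and \<open>E\<close>
        for the exponential. The case \<open>n = 0\<close> is separate because the exponent
        \<open>n - 1\<close> is truncated there; the factor \<open>real n\<close> then removes the
        term.\<close>
      have *: "real n * (- r\<^sup>2) * r ^ (n - 1) * E + E * r\<^sup>2 * r ^ n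
          = r ^ (n + 2) * E - real n * (r ^ (n + 1) * E)" for r E :: real
        by (cases n) (simp_all add: power2_eq_square algebra_simps)
      show ?thesis using 1 DERIV_mult[OF p e]
        unfolding * by (simp only: flat_def if_True)
    qed
    moreover have "eventually (\<lambda>t. (1 / t) ^ n * exp (- (1 / t)) = flat n t) (nhds t)"
      using eventually_nhds_in_open[of "{0<..}" t] 1
      by (auto elim!: eventually_mono simp: flat_def)
    ultimately show ?thesis
      by (rule DERIV_cong_ev[OF refl _ refl, THEN iffD1, rotated])
  next
    case 2
    \<comment> \<open>As \<open>flat n 0 = 0\<close>, the difference quotient at zero is
      \<open>flat (n + 1) h\<close>, so differentiability of one member is the limit at zero of the
      next.\<close>
    have "((\<lambda>h. (flat n (0 + h) - flat n 0) / h) \<longlongrightarrow> 0) (at 0)"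
      using flat_tendsto_0[of "n + 1"]
      by (rule Lim_transform_eventually) (auto simp: eventually_at_filter flat_def)
    then show ?thesis using 2 by (simp add: DERIV_def flat_def)
  next
    case 3
    have "((\<lambda>t. 0) has_real_derivative flat (n + 2) t - real n * flat (n + 1) t) (at t)"
      using 3 by (simp add: flat_def)
    moreover have "eventually (\<lambda>t. 0 = flat n t) (nhds t)"
      using eventually_nhds_in_open[of "{..<0}" t] 3
      by (auto elim!: eventually_mono simp: flat_def)
    ultimately show ?thesis
      by (rule DERIV_cong_ev[OF refl _ refl, THEN iffD1, rotated])
  qed
qed

text \<open>
  Closed under partial derivatives by the product rule, hence contained in the coinductively
  defined class of smooth functions.
\<close>

inductive smooth_alg :: "(real^'n::finite \<Rightarrow> complex) \<Rightarrow> bool" where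
  smooth: "smooth_fun f \<Longrightarrow> smooth_alg f"
| const: "smooth_alg (\<lambda>x. a)"
| flat: "smooth_alg (\<lambda>x. complex_of_real (flat n (s * x $ i + t)))"
| add: "smooth_alg f \<Longrightarrow> smooth_alg g \<Longrightarrow> smooth_alg (\<lambda>x. f x + g x)"
| mult: "smooth_alg f \<Longrightarrow> smooth_alg g \<Longrightarrow> smooth_alg (\<lambda>x. f x * g x)"
| cnj: "smooth_alg f \<Longrightarrow> smooth_alg (\<lambda>x. cnj (f x))"

lemma pderiv_i_mult:
  fixes f g :: "real^'n::finite \<Rightarrow> complex"
  assumes "f differentiable (at x)" "g differentiable (at x)"
  shows "pderiv_i i (\<lambda>x. f x * g x) x = f x * pderiv_i i g x + pderiv_i i f x * g x"
proof -
  have "((\<lambda>x. f x * g x) has_derivative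
      (\<lambda>h. f x * frechet_derivative g (at x) h + frechet_derivative f (at x) h * g x)) (at x)"
    using assms by (intro has_derivative_mult) (auto simp: frechet_derivative_works)
  from pderiv_i_eq[OF this] show ?thesis by (simp add: pderiv_i_def)
qed

lemma pderiv_i_cnj:
  fixes f :: "real^'n::finite \<Rightarrow> complex"
  assumes "f differentiable (at x)"
  shows "pderiv_i i (\<lambda>x. cnj (f x)) x = cnj (pderiv_i i f x)"
proof -
  have "((\<lambda>x. cnj (f x)) has_derivative (\<lambda>h. cnj (frechet_derivative f (at x) h))) (at x)"
    using assms by (intro has_derivative_cnj) (auto simp: frechet_derivative_works)
  from pderiv_i_eq[OF this] show ?thesis by (simp add: pderiv_i_def)
qed

lemma pderiv_i_add:
  fixes f g :: "real^'n::finite \<Rightarrow> 'b::real_normed_vector"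
  assumes "f differentiable (at x)" "g differentiable (at x)"
  shows "pderiv_i i (\<lambda>x. f x + g x) x = pderiv_i i f x + pderiv_i i g x"
proof -
  have "((\<lambda>x. f x + g x) has_derivative
      (\<lambda>h. frechet_derivative f (at x) h + frechet_derivative g (at x) h)) (at x)"
    using assms by (intro has_derivative_add) (auto simp: frechet_derivative_works)
  from pderiv_i_eq[OF this] show ?thesis by (simp add: pderiv_i_def)
qed

lemma flat_coord_has_derivative:
  "((\<lambda>x. complex_of_real (flat n (s * x $ i + t))) has_derivative
    (\<lambda>h. complex_of_real ((flat (n + 2) (s * x $ i + t) - real n * flat (n + 1) (s * x $ i + t))
        * (s * h $ i)))) (at x)"
proof -
  have "((\<lambda>x. s * x $ i + t) has_derivative (\<lambda>h. s * h $ i)) (at x)"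
    by (auto intro!: derivative_eq_intros bounded_linear.has_derivative[OF bounded_linear_vec_nth])
  from has_derivative_compose[OF this] flat_deriv[of n "s * x $ i + t"]
  have "((\<lambda>x. flat n (s * x $ i + t)) has_derivative
     (\<lambda>h. (flat (n + 2) (s * x $ i + t) - real n * flat (n + 1) (s * x $ i + t)) * (s * h $ i))) (at x)"
    by (auto simp: has_field_derivative_def o_def)
  then show ?thesis by (rule has_derivative_of_real)
qed

lemma smooth_alg_step:
  fixes f :: "real^'n::finite \<Rightarrow> complex"
  shows "smooth_alg f \<Longrightarrow> (\<forall>x. f differentiable (at x)) \<and> (\<forall>i. smooth_alg (pderiv_i i f))"
proof (induction rule: smooth_alg.induct)
  case (smooth f)
  then show ?case
    by (auto intro: smooth_alg.smooth smooth_fun_differentiable smooth_fun_pderiv)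
next
  case (const a)
  have "pderiv_i i (\<lambda>x. a) = (\<lambda>x::real^'n. 0)" for i :: 'n
    by (rule ext) (subst pderiv_i_eq[OF has_derivative_const], simp)
  then show ?case by (simp add: smooth_alg.const)
next
  case (flat n s k t)
  \<comment> \<open>The class has constructors for sums, products and constants but none for
    differences, hence the coefficient \<open>- real n\<close> inside a sum.\<close>
  have "pderiv_i i (\<lambda>x. complex_of_real (flat n (s * x $ k + t))) =
     (\<lambda>x. (of_real (flat (n + 2) (s * x $ k + t)) + of_real (- real n) * of_real (flat (n + 1) (s * x $ k + t)))
       * of_real (s * axis i 1 $ k))" for i
    by (rule ext) (subst pderiv_i_eq[OF flat_coord_has_derivative], simp)
  then show ?case
    by (auto intro!: smooth_alg.mult smooth_alg.add smooth_alg.const smooth_alg.flat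
       differentiableI[OF flat_coord_has_derivative] simp del: of_real_minus)
next
  case (add f g)
  have "pderiv_i i (\<lambda>x. f x + g x) = (\<lambda>x. pderiv_i i f x + pderiv_i i g x)" for i
    using add by (intro ext pderiv_i_add) auto
  then show ?case using add by (auto intro: smooth_alg.add)
next
  case (mult f g)
  have "pderiv_i i (\<lambda>x. f x * g x) = (\<lambda>x. f x * pderiv_i i g x + pderiv_i i f x * g x)" for i
    using mult by (intro ext pderiv_i_mult) auto
  then show ?case using mult by (auto intro!: smooth_alg.add smooth_alg.mult)
next
  case (cnj f)
  have "pderiv_i i (\<lambda>x. cnj (f x)) = (\<lambda>x. cnj (pderiv_i i f x))" for i
    using cnj by (intro ext pderiv_i_cnj) auto
  then show ?case using cnj
    by (auto intro!: smooth_alg.cnj simp: differentiable_cnj_iff)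
qed

lemma smooth_alg_imp_smooth_fun: "smooth_alg f \<Longrightarrow> smooth_fun f"
proof (coinduction arbitrary: f rule: smooth_fun.coinduct)
  case (smooth_fun f)
  from smooth_alg_step[OF this] show ?case by auto
qed

lemmas smooth_fun_const = smooth_alg_imp_smooth_fun[OF smooth_alg.const]
lemmas smooth_fun_flat = smooth_alg_imp_smooth_fun[OF smooth_alg.flat]

lemma smooth_fun_add:
  fixes f g :: "real^'n::finite \<Rightarrow> complex"
  shows "smooth_fun f \<Longrightarrow> smooth_fun g \<Longrightarrow> smooth_fun (\<lambda>x. f x + g x)"
  by (rule smooth_alg_imp_smooth_fun[OF smooth_alg.add[OF smooth_alg.smooth smooth_alg.smooth]])

lemma smooth_fun_mult:
  fixes f g :: "real^'n::finite \<Rightarrow> complex"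
  shows "smooth_fun f \<Longrightarrow> smooth_fun g \<Longrightarrow> smooth_fun (\<lambda>x. f x * g x)"
  by (rule smooth_alg_imp_smooth_fun[OF smooth_alg.mult[OF smooth_alg.smooth smooth_alg.smooth]])

lemma smooth_fun_cnj:
  fixes f :: "real^'n::finite \<Rightarrow> complex"
  shows "smooth_fun f \<Longrightarrow> smooth_fun (\<lambda>x. cnj (f x))"
  by (rule smooth_alg_imp_smooth_fun[OF smooth_alg.cnj[OF smooth_alg.smooth]])

lemma smooth_fun_prod:
  fixes f :: "'i \<Rightarrow> real^'n::finite \<Rightarrow> complex"
  assumes "finite I" "\<And>i. i \<in> I \<Longrightarrow> smooth_fun (f i)"
  shows "smooth_fun (\<lambda>x. \<Prod>i\<in>I. f i x)"
  using assms by (induction I rule: finite_induct) (auto intro: smooth_fun_mult smooth_fun_const)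

section \<open>Stability of test functions under algebra and differentiation\<close>

lemma test_fun_smooth: "\<phi> \<in> test_fun \<Omega> \<Longrightarrow> smooth_fun \<phi>"
  by (simp add: test_fun_def)

lemma test_funI:
  assumes "smooth_fun \<psi>" "compact K" "{x. \<psi> x \<noteq> 0} \<subseteq> K" "K \<subseteq> \<Omega>"
  shows "\<psi> \<in> test_fun \<Omega>"
proof -
  have sub: "closure {x. \<psi> x \<noteq> 0} \<subseteq> K"
    using assms(2,3) by (intro closure_minimal compact_imp_closed)
  moreover have "compact (closure {x. \<psi> x \<noteq> 0})"
    unfolding compact_closure using assms(2,3) bounded_subset compact_imp_bounded by blast
  ultimately show ?thesis using assms(1,4) unfolding test_fun_def by blast
qed

lemma test_fun_compact_support:
  assumes "\<phi> \<in> test_fun \<Omega>"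
  shows "compact (closure {x. \<phi> x \<noteq> 0})" "closure {x. \<phi> x \<noteq> 0} \<subseteq> \<Omega>"
  using assms unfolding test_fun_def by blast+

lemma test_fun_support_mono:
  assumes "\<phi> \<in> test_fun \<Omega>" "smooth_fun \<psi>" "{x. \<psi> x \<noteq> 0} \<subseteq> {x. \<phi> x \<noteq> 0}"
  shows "\<psi> \<in> test_fun \<Omega>"
  using test_funI[OF assms(2) test_fun_compact_support(1)[OF assms(1)] _ test_fun_compact_support(2)[OF assms(1)]]
    assms(3) closure_subset by blast

lemma test_fun_mult:
  "\<phi> \<in> test_fun \<Omega> \<Longrightarrow> smooth_fun \<psi> \<Longrightarrow> (\<lambda>x. \<phi> x * \<psi> x) \<in> test_fun \<Omega>"
  by (rule test_fun_support_mono) (auto intro: smooth_fun_mult test_fun_smooth)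

lemma test_fun_cnj: "\<phi> \<in> test_fun \<Omega> \<Longrightarrow> (\<lambda>x. cnj (\<phi> x)) \<in> test_fun \<Omega>"
  by (rule test_fun_support_mono) (auto intro: smooth_fun_cnj test_fun_smooth)

lemma test_fun_add:
  assumes "\<phi> \<in> test_fun \<Omega>" "\<psi> \<in> test_fun \<Omega>"
  shows "(\<lambda>x. \<phi> x + \<psi> x) \<in> test_fun \<Omega>"
proof -
  let ?S = "closure {x. \<phi> x \<noteq> 0} \<union> closure {x. \<psi> x \<noteq> 0}"
  have "{x. \<phi> x + \<psi> x \<noteq> 0} \<subseteq> {x. \<phi> x \<noteq> 0} \<union> {x. \<psi> x \<noteq> 0}" by auto
  also have "\<dots> \<subseteq> ?S" by (rule Un_mono[OF closure_subset closure_subset])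
  finally have "{x. \<phi> x + \<psi> x \<noteq> 0} \<subseteq> ?S" .
  then show ?thesis
    using assms[THEN test_fun_compact_support(1)] assms[THEN test_fun_compact_support(2)]
    by (intro test_funI[of _ ?S] smooth_fun_add assms[THEN test_fun_smooth] compact_Un Un_least)
qed

lemma test_fun_diff:
  assumes "\<phi> \<in> test_fun \<Omega>" "\<psi> \<in> test_fun \<Omega>"
  shows "(\<lambda>x. \<phi> x - \<psi> x) \<in> test_fun \<Omega>"
  using test_fun_add[OF assms(1) test_fun_mult[OF assms(2) smooth_fun_const[of "-1"]]] by simp

lemma pderiv_i_diff:
  fixes f g :: "real^'n::finite \<Rightarrow> 'b::real_normed_vector"
  assumes "f differentiable (at x)" "g differentiable (at x)"
  shows "pderiv_i i (\<lambda>x. f x - g x) x = pderiv_i i f x - pderiv_i i g x"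
proof -
  have "((\<lambda>x. f x - g x) has_derivative
      (\<lambda>h. frechet_derivative f (at x) h - frechet_derivative g (at x) h)) (at x)"
    using assms by (intro has_derivative_diff) (auto simp: frechet_derivative_works)
  from pderiv_i_eq[OF this] show ?thesis by (simp add: pderiv_i_def)
qed

text \<open>The complement of the closed support is an open set on which \<open>\<phi>\<close>
  coincides with zero, so the derivative there is that of zero.\<close>

lemma pderiv_i_zero_outside:
  assumes "x \<notin> closure {x. \<phi> x \<noteq> 0}"
  shows "pderiv_i i \<phi> x = 0"
proof -
  have "(\<phi> has_derivative (\<lambda>h. 0)) (at x)"
  proof (rule has_derivative_transform_within_open[where f="\<lambda>x. 0"])
    show "open (- closure {x. \<phi> x \<noteq> 0})" by (rule open_Compl[OF closed_closure])
    show "0 = \<phi> y" if "y \<in> - closure {x. \<phi> x \<noteq> 0}" for y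
      using that closure_subset[of "{x. \<phi> x \<noteq> 0}"] by auto
  qed (use assms in auto)
  from pderiv_i_eq[OF this] show ?thesis by simp
qed

lemma test_fun_pderiv: "\<phi> \<in> test_fun \<Omega> \<Longrightarrow> pderiv_i i \<phi> \<in> test_fun \<Omega>"
proof -
  assume \<phi>: "\<phi> \<in> test_fun \<Omega>"
  have "{x. pderiv_i i \<phi> x \<noteq> 0} \<subseteq> closure {x. \<phi> x \<noteq> 0}"
    using pderiv_i_zero_outside by blast
  then show ?thesis
    by (rule test_funI[OF smooth_fun_pderiv[OF test_fun_smooth[OF \<phi>]]
          test_fun_compact_support(1)[OF \<phi>] _ test_fun_compact_support(2)[OF \<phi>]])
qed

text \<open>For \<open>t > 0\<close>, \<open>flat 0 (k t)\<close> is the \<open>k\<close>-th root of \<open>flat 0 t\<close> and hence tends to 1.\<close>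

definition bump :: "real^'n::finite \<Rightarrow> real^'n \<Rightarrow> nat \<Rightarrow> real^'n \<Rightarrow> real" where
  "bump a b k x = (\<Prod>i\<in>UNIV. flat 0 (real k * (x $ i - a $ i)) * flat 0 (real k * (b $ i - x $ i)))"

lemma flat_0_bounds: "0 \<le> flat 0 t" "flat 0 t \<le> 1"
  by (auto simp: flat_def)

lemma bump_bounds: "0 \<le> bump a b k x" "bump a b k x \<le> 1"
  unfolding bump_def by (auto intro!: prod_nonneg prod_le_1 mult_nonneg_nonneg mult_le_one flat_0_bounds)

lemma smooth_fun_bump: "smooth_fun (\<lambda>x. complex_of_real (bump a b k x))"
proof -
  have "smooth_fun (\<lambda>x. \<Prod>i\<in>UNIV. complex_of_real (flat 0 (real k * x $ i + (- real k * a $ i)))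
      * complex_of_real (flat 0 (- real k * x $ i + real k * b $ i)))"
    by (intro smooth_fun_prod smooth_fun_mult smooth_fun_flat) auto
  then show ?thesis by (simp add: bump_def algebra_simps)
qed

lemma bump_nonzero_iff: "k > 0 \<Longrightarrow> bump a b k x \<noteq> 0 \<longleftrightarrow> x \<in> box a b"
proof -
  assume k: "k > 0"
  have *: "flat 0 t \<noteq> 0 \<longleftrightarrow> t > 0" for t by (auto simp: flat_def)
  show ?thesis using k
    by (auto simp: bump_def mem_box_cart * zero_less_mult_iff)
qed

text \<open>This pointwise limit, together with the bounds 0 and 1, lets dominated convergence pass
  from test functions to integrals over boxes. The parameter is \<open>Suc k\<close> because
  \<open>bump a b 0\<close> vanishes identically.\<close>

lemma bump_tendsto:
  fixes a b x :: "real^'n::finite"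
  shows "(\<lambda>k. bump a b (Suc k) x) \<longlonglongrightarrow> indicator (box a b) x"
proof (cases "x \<in> box a b")
  case True
  have F: "(\<lambda>k. flat 0 (real (Suc k) * t)) \<longlonglongrightarrow> 1" if "t > 0" for t
  proof -
    have "(\<lambda>k. exp (- ((1 / t) * inverse (real (Suc k))))) \<longlonglongrightarrow> exp (- ((1 / t) * 0))"
      by (intro tendsto_intros LIMSEQ_inverse_real_of_nat)
    moreover have "flat 0 (real (Suc k) * t) = exp (- ((1 / t) * inverse (real (Suc k))))" for k
      using that by (simp add: flat_def divide_inverse zero_less_mult_iff mult.commute del: of_nat_Suc)
    ultimately show ?thesis by simp
  qed
  have "(\<lambda>k. bump a b (Suc k) x) \<longlonglongrightarrow> (\<Prod>i\<in>(UNIV::'n set). 1 * 1)"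
    unfolding bump_def
    by (intro tendsto_prod tendsto_mult F) (use True in \<open>auto simp: mem_box_cart\<close>)
  then show ?thesis using True by simp
next
  case False
  then have "bump a b (Suc k) x = 0" for k using bump_nonzero_iff[of "Suc k"] by blast
  then show ?thesis using False by simp
qed

lemma bump_test_fun:
  assumes "cbox a b \<subseteq> \<Omega>" "k > 0"
  shows "(\<lambda>x. complex_of_real (bump a b k x)) \<in> test_fun \<Omega>"
proof -
  have e: "{x. complex_of_real (bump a b k x) \<noteq> 0} = box a b"
    using bump_nonzero_iff[OF assms(2)] by auto
  show ?thesis
    by (rule test_funI[OF smooth_fun_bump compact_cbox _ assms(1)])
       (unfold e, rule box_subset_cbox)
qed

section \<open>Uniqueness of weak derivatives\<close>

lemma sigma_finite_lebesgue: "sigma_finite_measure (lebesgue :: (real^'n::finite) measure)"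
proof
  let ?B = "\<lambda>i::nat. box (- (real i *\<^sub>R One)) (real i *\<^sub>R One) :: (real^'n) set"
  show "\<exists>A. countable A \<and> A \<subseteq> sets lebesgue \<and> \<Union>A = space (lebesgue :: (real^'n) measure) \<and>
      (\<forall>a\<in>A. emeasure lebesgue a \<noteq> \<infinity>)"
    by (rule exI[of _ "range ?B"]) (auto simp: UN_box_eq_UNIV emeasure_lborel_box_eq)
qed

text \<open>Open boxes are stable under intersection and generate the Borel sets, and the Borel sets
  over which \<open>H\<close> integrates to zero are closed under complements and disjoint unions.
  So all Borel sets, and up to null sets all Lebesgue sets, have zero integral, which forces
  \<open>H\<close> to vanish almost everywhere.\<close>

lemma integral_box_zero_imp_AE:
  fixes H :: "real^'n::finite \<Rightarrow> complex"
  assumes H: "integrable lebesgue H"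
    and box: "\<And>a b. (LINT x:box a b|lebesgue. H x) = 0"
  shows "AE x in lebesgue. H x = 0"
proof -
  let ?G = "range (\<lambda>(a, b). box a b :: (real^'n) set)"
  have sig: "sigma_sets UNIV ?G = sets borel"
    by (subst borel_eq_box) (simp add: sets_measure_of)
  have leb: "E \<in> sets lebesgue" if "E \<in> sets borel" for E :: "(real^'n) set"
    using that by simp
  have int: "set_integrable lebesgue E H" if "E \<in> sets borel" for E
    unfolding set_integrable_def using that H by (intro integrable_mult_indicator leb)
  \<comment> \<open>The whole space is not a box but an increasing union of boxes; its integral is
    needed for the complements in the induction below.\<close>
  have all: "(\<integral>x. H x \<partial>lebesgue) = 0"
  proof -
    let ?B = "\<lambda>i::nat. box (- (real i *\<^sub>R One)) (real i *\<^sub>R One) :: (real^'n) set"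
    have "incseq ?B"
    proof (rule monoI)
      fix m n :: nat assume "m \<le> n"
      then have "real m \<le> real n" by simp
      then show "?B m \<subseteq> ?B n" by (simp add: subset_box)
    qed
    then have "(\<lambda>i. LINT x:?B i|lebesgue. H x) \<longlonglongrightarrow> (LINT x:(\<Union>i. ?B i)|lebesgue. H x)"
      by (intro set_integral_cont_up int) auto
    then have "(\<lambda>i::nat. 0::complex) \<longlonglongrightarrow> (LINT x:UNIV|lebesgue. H x)"
      by (simp add: box UN_box_eq_UNIV)
    then show ?thesis
      by (simp add: set_lebesgue_integral_def LIMSEQ_const_iff)
  qed
  have bor: "(LINT x:E|lebesgue. H x) = 0" if "E \<in> sets borel" for E
  proof -
    have "Int_stable ?G" by (auto simp: Int_stable_def box_Int_box)
    moreover have "?G \<subseteq> Pow UNIV" by simp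
    moreover have "E \<in> sigma_sets UNIV ?G" using that by (simp add: sig)
    ultimately show ?thesis
    proof (induction rule: sigma_sets_induct_disjoint)
      case (basic A)
      then show ?case using box by auto
    next
      case empty
      show ?case by (simp add: set_lebesgue_integral_def)
    next
      case (compl A)
      then have A: "A \<in> sets borel" by (simp add: sig)
      have "(LINT x:UNIV - A|lebesgue. H x)
          = (\<integral>x. H x - indicator A x *\<^sub>R H x \<partial>lebesgue)"
        unfolding set_lebesgue_integral_def
        by (rule Bochner_Integration.integral_cong) (auto simp: indicator_def)
      also have "\<dots> = 0"
        using int[OF A] H compl.IH all
        by (simp add: set_integrable_def set_lebesgue_integral_def)
      finally show ?case .
    next
      case (union A)
      have A: "A i \<in> sets borel" for i using union(2) by (auto simp: sig)
      have "(LINT x:(\<Union>i. A i)|lebesgue. H x) = (\<Sum>i. (LINT x:A i|lebesgue. H x))"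
        using union(1) A
        by (intro lebesgue_integral_countable_add leb int sets.countable_UN)
           (auto simp: disjoint_family_on_def)
      then show ?case by (simp add: union.IH)
    qed
  qed
  interpret sigma_finite_measure "lebesgue :: (real^'n) measure" by (rule sigma_finite_lebesgue)
  show ?thesis
  proof (rule density_zero[OF H])
    fix A :: "(real^'n) set" assume A: "A \<in> sets lebesgue"
    \<comment> \<open>A Lebesgue measurable set differs from its Borel main part only by a null
      set.\<close>
    have ae: "AE x in lebesgue. x \<in> main_part lborel A \<longleftrightarrow> x \<in> A"
      using AE_completion[OF AE_in_main_part[of A lborel]] A by simp
    have M: "main_part lborel A \<in> sets borel"
      using main_part_sets[of A lborel] A by simp
    have "(LINT x:A|lebesgue. H x) = (LINT x:main_part lborel A|lebesgue. H x)"
      unfolding set_lebesgue_integral_def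
      using H A M ae leb[OF M]
      by (intro integral_cong_AE borel_measurable_scaleR borel_measurable_indicator)
         (auto simp: indicator_def elim!: eventually_mono)
    then show "(LINT x:A|lebesgue. H x) = 0" using bor[OF M] by simp
  qed
qed

lemma AE_lebesgue_on_iff:
  "\<Omega> \<in> sets lebesgue \<Longrightarrow> (AE x in lebesgue_on \<Omega>. P x) \<longleftrightarrow> (AE x in lebesgue. x \<in> \<Omega> \<longrightarrow> P x)"
  by (rule AE_restrict_space_iff) simp

lemma continuous_lebesgue_measurable:
  fixes f :: "real^'n::finite \<Rightarrow> 'b::topological_space"
  shows "continuous_on UNIV f \<Longrightarrow> f \<in> borel_measurable (lebesgue_on \<Omega>)"
  by (intro measurable_restrict_space1 measurable_completion)
     (simp add: borel_measurable_continuous_onI)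

text \<open>\<open>h\<close> itself need not be integrable, only its products with test functions.
  Multiplying by one fixed bump gives a function \<open>H\<close> that is integrable on the whole
  space once extended by zero. Further bumps show that \<open>H\<close> integrates to zero over
  every box, and the fixed bump is nonzero on \<open>box a b\<close>, so it can be divided
  out.\<close>

lemma AE_zero_on_box:
  fixes h :: "real^'n::finite \<Rightarrow> complex"
  assumes \<Omega>: "\<Omega> \<in> sets lebesgue"
    and h: "\<And>\<phi>. \<phi> \<in> test_fun \<Omega> \<Longrightarrow> integrable (lebesgue_on \<Omega>) (\<lambda>x. h x * \<phi> x)
        \<and> (\<integral>x. h x * \<phi> x \<partial>lebesgue_on \<Omega>) = 0"
    and sub: "cbox a b \<subseteq> \<Omega>"
  shows "AE x in lebesgue. x \<in> box a b \<longrightarrow> h x = 0"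
proof -
  let ?\<Phi> = "\<lambda>x. complex_of_real (bump a b 1 x)"
  have \<Phi>: "?\<Phi> \<in> test_fun \<Omega>" using sub by (rule bump_test_fun) simp
  define H where "H = (\<lambda>x. indicator \<Omega> x *\<^sub>R (h x * ?\<Phi> x))"
  have \<Omega>': "\<Omega> \<inter> space lebesgue \<in> sets lebesgue" using \<Omega> by simp
  have HI: "integrable lebesgue H"
    using h[OF \<Phi>] unfolding H_def integrable_restrict_space[OF \<Omega>'] by simp
  have meas: "(\<lambda>x. bump a' b' k x) \<in> borel_measurable lebesgue" for a' b' :: "real^'n" and k
  proof -
    have "continuous_on UNIV (\<lambda>x. Re (complex_of_real (bump a' b' k x)))"
      by (intro continuous_on_Re smooth_fun_continuous smooth_fun_bump)
    from continuous_lebesgue_measurable[OF this, of UNIV]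
    show ?thesis by (simp add: lebesgue_on_UNIV_eq)
  qed
  have "AE x in lebesgue. H x = 0"
  proof (rule integral_box_zero_imp_AE[OF HI])
    fix a' b' :: "real^'n"
    let ?s = "\<lambda>k x. bump a' b' (Suc k) x *\<^sub>R H x"
    have z: "(\<integral>x. ?s k x \<partial>lebesgue) = 0" for k
    proof -
      \<comment> \<open>The second box may leave \<open>\<Omega>\<close>; the fixed factor keeps the
        support of the product inside.\<close>
      have "(\<lambda>x. ?\<Phi> x * complex_of_real (bump a' b' (Suc k) x)) \<in> test_fun \<Omega>"
        by (intro test_fun_mult \<Phi> smooth_fun_bump)
      from h[OF this] show ?thesis
        unfolding integral_restrict_space[OF \<Omega>'] H_def by (simp add: scaleR_conv_of_real mult_ac)
    qed
    have "(\<lambda>k. \<integral>x. ?s k x \<partial>lebesgue) \<longlonglongrightarrow> (LINT x:box a' b'|lebesgue. H x)"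
      unfolding set_lebesgue_integral_def
    proof (rule integral_dominated_convergence[where w = "\<lambda>x. norm (H x)"])
      show "AE x in lebesgue. (\<lambda>k. ?s k x) \<longlonglongrightarrow> indicat_real (box a' b') x *\<^sub>R H x"
        by (intro AE_I2 tendsto_scaleR bump_tendsto tendsto_const)
      show "AE x in lebesgue. norm (?s k x) \<le> norm (H x)" for k
        by (intro AE_I2) (simp add: bump_bounds mult_left_le_one_le)
    qed (use HI meas in \<open>auto intro!: borel_measurable_scaleR borel_measurable_indicator\<close>)
    then show "(LINT x:box a' b'|lebesgue. H x) = 0"
      by (simp add: z LIMSEQ_const_iff)
  qed
  then show ?thesis
  proof (rule eventually_mono)
    fix x assume "H x = 0"
    then show "x \<in> box a b \<longrightarrow> h x = 0"
      using bump_nonzero_iff[of 1 a b x] sub box_subset_cbox[of a b]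
      by (auto simp: H_def indicator_def split: if_splits)
  qed
qed

text \<open>An open set is a countable union of closed boxes, and their faces are null sets, so
  vanishing on the open boxes is enough.\<close>

lemma fundamental_lemma_calculus_of_variations:
  fixes h :: "real^'n::finite \<Rightarrow> complex"
  assumes \<Omega>: "open \<Omega>"
    and h: "\<And>\<phi>. \<phi> \<in> test_fun \<Omega> \<Longrightarrow> integrable (lebesgue_on \<Omega>) (\<lambda>x. h x * \<phi> x)
        \<and> (\<integral>x. h x * \<phi> x \<partial>lebesgue_on \<Omega>) = 0"
  shows "AE x in lebesgue_on \<Omega>. h x = 0"
proof -
  have \<Omega>': "\<Omega> \<in> sets lebesgue" using \<Omega> by simp
  obtain D where D: "countable D" "D \<subseteq> Pow \<Omega>" "\<And>X. X \<in> D \<Longrightarrow> \<exists>a b. X = cbox a b" "\<Union>D = \<Omega>"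
    using open_countable_Union_open_cbox[OF \<Omega>] by metis
  have "AE x in lebesgue. x \<in> X \<longrightarrow> h x = 0" if X: "X \<in> D" for X
  proof -
    obtain a b where ab: "X = cbox a b" using D(3)[OF X] by blast
    then have sub: "cbox a b \<subseteq> \<Omega>" using X D(2) by auto
    have "AE x in lebesgue. x \<in> box a b \<longrightarrow> h x = 0"
      by (rule AE_zero_on_box[OF \<Omega>' _ sub]) (rule h)
    moreover have "AE x in lebesgue. x \<notin> cbox a b - box a b"
      using negligible_frontier_interval[of a b] unfolding negligible_iff_null_sets
      by (rule AE_not_in)
    ultimately show ?thesis unfolding ab by eventually_elim blast
  qed
  then have "AE x in lebesgue. \<forall>X\<in>D. x \<in> X \<longrightarrow> h x = 0"
    unfolding AE_ball_countable[OF D(1)] by blast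
  then show ?thesis unfolding AE_lebesgue_on_iff[OF \<Omega>']
    by eventually_elim (use D(4) in blast)
qed

lemma weak_grad_unique:
  assumes "open \<Omega>" "weak_grad \<Omega> u g" "weak_grad \<Omega> u g'"
  shows "AE x in lebesgue_on \<Omega>. g x = g' x"
proof -
  have "AE x in lebesgue_on \<Omega>. g x $ i - g' x $ i = 0" for i
    by (rule fundamental_lemma_calculus_of_variations[OF assms(1)])
       (use assms(2,3) in \<open>auto simp: weak_grad_def left_diff_distrib\<close>)
  then have "AE x in lebesgue_on \<Omega>. \<forall>i\<in>UNIV. g x $ i - g' x $ i = 0"
    by (intro AE_finite_allI) auto
  then show ?thesis by eventually_elim (simp add: vec_eq_iff)
qed

lemma weak_div_unique:
  assumes "open \<Omega>" "weak_div \<Omega> q w" "weak_div \<Omega> q w'"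
  shows "AE x in lebesgue_on \<Omega>. w x = w' x"
proof -
  have "AE x in lebesgue_on \<Omega>. w x - w' x = 0"
    by (rule fundamental_lemma_calculus_of_variations[OF assms(1)])
       (use assms(2,3) in \<open>auto simp: weak_div_def left_diff_distrib\<close>)
  then show ?thesis by simp
qed

lemma weak_grad_diff:
  "weak_grad \<Omega> u g \<Longrightarrow> weak_grad \<Omega> v h \<Longrightarrow> weak_grad \<Omega> (\<lambda>x. u x - v x) (\<lambda>x. g x - h x)"
  by (simp add: weak_grad_def left_diff_distrib)

lemma weak_div_diff:
  "weak_div \<Omega> q w \<Longrightarrow> weak_div \<Omega> r v \<Longrightarrow> weak_div \<Omega> (\<lambda>x. q x - r x) (\<lambda>x. w x - v x)"
  by (simp add: weak_div_def left_diff_distrib sum_subtractf)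

lemma weak_grad_wgrad: "weak_grad \<Omega> u g \<Longrightarrow> weak_grad \<Omega> u (wgrad \<Omega> u)"
  unfolding wgrad_def by (rule someI[of "weak_grad \<Omega> u"])

lemma weak_div_wdiv: "weak_div \<Omega> q w \<Longrightarrow> weak_div \<Omega> q (wdiv \<Omega> q)"
  unfolding wdiv_def by (rule someI[of "weak_div \<Omega> q"])

section \<open>Square integrable functions\<close>

text \<open>Lebesgue measure is complete, so a change on a null set preserves measurability; the
  indicator transfers the question to the whole space.\<close>

lemma lebesgue_on_measurable_AE:
  fixes f g :: "real^'n::finite \<Rightarrow> 'b::euclidean_space"
  assumes \<Omega>: "\<Omega> \<in> sets lebesgue" and f: "f \<in> borel_measurable (lebesgue_on \<Omega>)"
    and ae: "AE x in lebesgue_on \<Omega>. f x = g x"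
  shows "g \<in> borel_measurable (lebesgue_on \<Omega>)"
proof -
  have \<Omega>': "\<Omega> \<inter> space lebesgue \<in> sets lebesgue" using \<Omega> by simp
  have "(\<lambda>x. indicator \<Omega> x *\<^sub>R f x) \<in> borel_measurable lebesgue"
    using f unfolding borel_measurable_restrict_space_iff[OF \<Omega>'] .
  moreover have "AE x in lebesgue. indicator \<Omega> x *\<^sub>R f x = indicator \<Omega> x *\<^sub>R g x"
    using ae unfolding AE_lebesgue_on_iff[OF \<Omega>] by eventually_elim (auto simp: indicator_def)
  ultimately have "(\<lambda>x. indicator \<Omega> x *\<^sub>R g x) \<in> borel_measurable lebesgue"
    by (rule borel_measurable_AE)
  then show ?thesis unfolding borel_measurable_restrict_space_iff[OF \<Omega>'] .
qed

lemma L2_measurable: "L2 \<Omega> f \<Longrightarrow> f \<in> borel_measurable (lebesgue_on \<Omega>)"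
  by (simp add: L2_def)

lemma L2_integrable: "L2 \<Omega> f \<Longrightarrow> integrable (lebesgue_on \<Omega>) (\<lambda>x. (cmod (f x))\<^sup>2)"
  by (simp add: L2_def)

lemma L2_AE_cong:
  assumes \<Omega>: "\<Omega> \<in> sets lebesgue" and f: "L2 \<Omega> f" and ae: "AE x in lebesgue_on \<Omega>. f x = g x"
  shows "L2 \<Omega> g"
proof -
  have g[measurable]: "g \<in> borel_measurable (lebesgue_on \<Omega>)"
    using lebesgue_on_measurable_AE[OF \<Omega> L2_measurable[OF f] ae] .
  have "integrable (lebesgue_on \<Omega>) (\<lambda>x. (cmod (g x))\<^sup>2)"
    using L2_integrable[OF f]
    by (rule integrable_cong_AE_imp) (use ae in \<open>auto elim: eventually_mono\<close>)
  with g show ?thesis by (simp add: L2_def)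
qed

lemma L2_dominated:
  assumes f: "L2 \<Omega> f" and g: "g \<in> borel_measurable (lebesgue_on \<Omega>)"
    and le: "AE x in lebesgue_on \<Omega>. cmod (g x) \<le> C * cmod (f x)"
  shows "L2 \<Omega> g"
proof -
  note [measurable] = g
  have "integrable (lebesgue_on \<Omega>) (\<lambda>x. (cmod (g x))\<^sup>2)"
  proof (rule Bochner_Integration.integrable_bound)
    show "integrable (lebesgue_on \<Omega>) (\<lambda>x. C\<^sup>2 * (cmod (f x))\<^sup>2)"
      using L2_integrable[OF f] by simp
    show "AE x in lebesgue_on \<Omega>. norm ((cmod (g x))\<^sup>2) \<le> norm (C\<^sup>2 * (cmod (f x))\<^sup>2)"
      using le
    proof eventually_elim
      case (elim x)
      then have "(cmod (g x))\<^sup>2 \<le> (C * cmod (f x))\<^sup>2" by (intro power_mono) auto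
      then show ?case by (simp add: power_mult_distrib)
    qed
  qed measurable
  with g show ?thesis by (simp add: L2_def)
qed

lemma L2_bounded_mult:
  assumes "L2 \<Omega> f" "m \<in> borel_measurable (lebesgue_on \<Omega>)"
    "AE x in lebesgue_on \<Omega>. cmod (m x) \<le> C"
  shows "L2 \<Omega> (\<lambda>x. m x * f x)"
proof -
  note [measurable] = assms(2) L2_measurable[OF assms(1)]
  show ?thesis
    by (rule L2_dominated[OF assms(1), where C = C])
       (use assms(3) in \<open>auto elim!: eventually_mono simp: norm_mult intro: mult_right_mono\<close>)
qed

lemma borel_measurable_cnj: "f \<in> borel_measurable M \<Longrightarrow> (\<lambda>x. cnj (f x)) \<in> borel_measurable M"
  by (rule borel_measurable_continuous_on[OF continuous_on_cnj[OF continuous_on_id]])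

lemma L2_cnj: "L2 \<Omega> f \<Longrightarrow> L2 \<Omega> (\<lambda>x. cnj (f x))"
  by (auto simp: L2_def intro: borel_measurable_cnj)

lemma L2_add:
  assumes f: "L2 \<Omega> f" and g: "L2 \<Omega> g"
  shows "L2 \<Omega> (\<lambda>x. f x + g x)"
proof -
  note [measurable] = L2_measurable[OF f] L2_measurable[OF g]
  have "integrable (lebesgue_on \<Omega>) (\<lambda>x. (cmod (f x + g x))\<^sup>2)"
  proof (rule Bochner_Integration.integrable_bound)
    show "integrable (lebesgue_on \<Omega>) (\<lambda>x. 2 * (cmod (f x))\<^sup>2 + 2 * (cmod (g x))\<^sup>2)"
      using L2_integrable[OF f] L2_integrable[OF g] by simp
    show "AE x in lebesgue_on \<Omega>. norm ((cmod (f x + g x))\<^sup>2)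
        \<le> norm (2 * (cmod (f x))\<^sup>2 + 2 * (cmod (g x))\<^sup>2)"
    proof (rule AE_I2)
      fix x
      have "(cmod (f x + g x))\<^sup>2 \<le> (cmod (f x) + cmod (g x))\<^sup>2"
        by (intro power_mono norm_triangle_ineq) auto
      also have "\<dots> \<le> 2 * (cmod (f x))\<^sup>2 + 2 * (cmod (g x))\<^sup>2"
        using sum_squares_bound[of "cmod (f x)" "cmod (g x)"] by (simp add: power2_sum)
      finally show "norm ((cmod (f x + g x))\<^sup>2) \<le> norm (2 * (cmod (f x))\<^sup>2 + 2 * (cmod (g x))\<^sup>2)"
        by simp
    qed
  qed measurable
  then show ?thesis by (simp add: L2_def)
qed

lemma L2_diff:
  assumes "L2 \<Omega> f" "L2 \<Omega> g"
  shows "L2 \<Omega> (\<lambda>x. f x - g x)"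
  using L2_add[OF assms(1) L2_bounded_mult[OF assms(2), of "\<lambda>_. -1" 1]] by simp

lemma L2_zero: "L2 \<Omega> (\<lambda>x. 0)"
  by (simp add: L2_def)

lemma L2_sum: "(\<And>i. i \<in> I \<Longrightarrow> L2 \<Omega> (f i)) \<Longrightarrow> L2 \<Omega> (\<lambda>x. \<Sum>i\<in>I. f i x)"
  by (induction I rule: infinite_finite_induct) (auto intro: L2_zero L2_add)

lemma L2_mult_integrable:
  assumes f: "L2 \<Omega> f" and g: "L2 \<Omega> g"
  shows "integrable (lebesgue_on \<Omega>) (\<lambda>x. f x * g x)"
proof -
  note [measurable] = L2_measurable[OF f] L2_measurable[OF g]
  show ?thesis
  proof (rule Bochner_Integration.integrable_bound)
    show "integrable (lebesgue_on \<Omega>) (\<lambda>x. (cmod (f x))\<^sup>2 + (cmod (g x))\<^sup>2)"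
      using L2_integrable[OF f] L2_integrable[OF g] by simp
    show "AE x in lebesgue_on \<Omega>. norm (f x * g x) \<le> norm ((cmod (f x))\<^sup>2 + (cmod (g x))\<^sup>2)"
    proof (rule AE_I2)
      fix x
      have "2 * cmod (f x) * cmod (g x) \<le> (cmod (f x))\<^sup>2 + (cmod (g x))\<^sup>2"
        by (rule sum_squares_bound)
      moreover have "0 \<le> cmod (f x) * cmod (g x)" by simp
      ultimately have "cmod (f x) * cmod (g x) \<le> (cmod (f x))\<^sup>2 + (cmod (g x))\<^sup>2" by linarith
      then show "norm (f x * g x) \<le> norm ((cmod (f x))\<^sup>2 + (cmod (g x))\<^sup>2)"
        by (simp add: norm_mult)
    qed
  qed measurable
qed

text \<open>The integral of the square of \<open>s * cmod (f x) - cmod (g x)\<close> is a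
  nonnegative quadratic polynomial in \<open>s\<close>.\<close>

lemma L2_Cauchy_Schwarz:
  assumes f: "L2 \<Omega> f" and g: "L2 \<Omega> g"
  shows "cmod (\<integral>x. f x * g x \<partial>lebesgue_on \<Omega>)
    \<le> sqrt (\<integral>x. (cmod (f x))\<^sup>2 \<partial>lebesgue_on \<Omega>) * sqrt (\<integral>x. (cmod (g x))\<^sup>2 \<partial>lebesgue_on \<Omega>)"
proof -
  define a where "a = (\<integral>x. (cmod (f x))\<^sup>2 \<partial>lebesgue_on \<Omega>)"
  define b where "b = (\<integral>x. (cmod (g x))\<^sup>2 \<partial>lebesgue_on \<Omega>)"
  define c where "c = (\<integral>x. cmod (f x * g x) \<partial>lebesgue_on \<Omega>)"
  have a0: "a \<ge> 0" and b0: "b \<ge> 0" and c0: "c \<ge> 0" unfolding a_def b_def c_def by auto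
  have quad: "0 \<le> s\<^sup>2 * a - 2 * s * c + b" for s
  proof -
    have i: "integrable (lebesgue_on \<Omega>) (\<lambda>x. cmod (f x * g x))"
      using L2_mult_integrable[OF f g] by (rule integrable_norm)
    have "0 \<le> (\<integral>x. (s * cmod (f x) - cmod (g x))\<^sup>2 \<partial>lebesgue_on \<Omega>)" by simp
    also have "\<dots> = (\<integral>x. s\<^sup>2 * (cmod (f x))\<^sup>2 - 2 * s * cmod (f x * g x) + (cmod (g x))\<^sup>2 \<partial>lebesgue_on \<Omega>)"
      by (simp add: power2_diff power_mult_distrib norm_mult algebra_simps)
    also have "\<dots> = s\<^sup>2 * a - 2 * s * c + b"
      unfolding a_def b_def c_def using L2_integrable[OF f] L2_integrable[OF g] i by simp
    finally show ?thesis .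
  qed
  have "c\<^sup>2 \<le> a * b"
  proof (cases "a = 0")
    case True
    have "c = 0"
    proof (rule ccontr)
      assume "c \<noteq> 0"
      \<comment> \<open>For \<open>a = 0\<close> the polynomial is affine in \<open>s\<close>; at
        this point its value is \<open>- b - 2\<close>, which is negative.\<close>
      with quad[of "(b + 1) / c"] True b0 show False by simp
    qed
    then show ?thesis using True by simp
  next
    case False
    then have "a > 0" using a0 by simp
    have "0 \<le> a * ((c / a)\<^sup>2 * a - 2 * (c / a) * c + b)"
      \<comment> \<open>The minimum of the quadratic is attained at \<open>c / a\<close>.\<close>
      using quad[of "c / a"] a0 by (rule mult_nonneg_nonneg[rotated])
    also have "\<dots> = a * b - c\<^sup>2" using \<open>a > 0\<close> by (simp add: field_simps power2_eq_square)
    finally show ?thesis by simp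
  qed
  then have "c \<le> sqrt (a * b)" by (rule real_le_rsqrt)
  moreover have "cmod (\<integral>x. f x * g x \<partial>lebesgue_on \<Omega>) \<le> c"
    unfolding c_def by (rule integral_norm_bound)
  ultimately show ?thesis by (simp add: real_sqrt_mult a_def b_def)
qed

section \<open>Convergence in square mean\<close>

text \<open>Membership in L2 is part of the notion because the integral of a non-integrable function
  is zero by convention, so convergence of the integrals alone would not control the
  functions.\<close>

definition L2_lim :: "(real^'n::finite) set \<Rightarrow> (nat \<Rightarrow> real^'n \<Rightarrow> complex) \<Rightarrow> (real^'n \<Rightarrow> complex) \<Rightarrow> bool"
  where "L2_lim \<Omega> F f \<longleftrightarrow> (\<forall>k. L2 \<Omega> (F k)) \<and> L2 \<Omega> f
    \<and> (\<lambda>k. \<integral>x. (cmod (F k x - f x))\<^sup>2 \<partial>lebesgue_on \<Omega>) \<longlonglongrightarrow> 0"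

lemma L2_lim_const: "L2 \<Omega> f \<Longrightarrow> L2_lim \<Omega> (\<lambda>k. f) f"
  by (simp add: L2_lim_def)

lemma L2_lim_cnj: "L2_lim \<Omega> F f \<Longrightarrow> L2_lim \<Omega> (\<lambda>k x. cnj (F k x)) (\<lambda>x. cnj (f x))"
  by (simp add: L2_lim_def L2_cnj flip: complex_cnj_diff)

lemma L2_lim_bounded_mult:
  assumes F: "L2_lim \<Omega> F f" and m: "m \<in> borel_measurable (lebesgue_on \<Omega>)"
    and C: "AE x in lebesgue_on \<Omega>. cmod (m x) \<le> C"
  shows "L2_lim \<Omega> (\<lambda>k x. m x * F k x) (\<lambda>x. m x * f x)"
proof -
  have L: "L2 \<Omega> (F k)" "L2 \<Omega> f" for k using F by (auto simp: L2_lim_def)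
  have D: "(\<lambda>k. \<integral>x. (cmod (F k x - f x))\<^sup>2 \<partial>lebesgue_on \<Omega>) \<longlonglongrightarrow> 0"
    using F by (simp add: L2_lim_def)
  have "(\<lambda>k. \<integral>x. (cmod (m x * F k x - m x * f x))\<^sup>2 \<partial>lebesgue_on \<Omega>) \<longlonglongrightarrow> 0"
  proof (rule tendsto_sandwich[OF _ _ tendsto_const])
    show "(\<lambda>k. C\<^sup>2 * (\<integral>x. (cmod (F k x - f x))\<^sup>2 \<partial>lebesgue_on \<Omega>)) \<longlonglongrightarrow> 0"
      using tendsto_mult_left[OF D, of "C\<^sup>2"] by simp
    show "\<forall>\<^sub>F k in sequentially. (\<integral>x. (cmod (m x * F k x - m x * f x))\<^sup>2 \<partial>lebesgue_on \<Omega>)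
        \<le> C\<^sup>2 * (\<integral>x. (cmod (F k x - f x))\<^sup>2 \<partial>lebesgue_on \<Omega>)"
    proof (rule always_eventually, rule allI)
      fix k
      have "(\<integral>x. (cmod (m x * F k x - m x * f x))\<^sup>2 \<partial>lebesgue_on \<Omega>)
          \<le> (\<integral>x. C\<^sup>2 * (cmod (F k x - f x))\<^sup>2 \<partial>lebesgue_on \<Omega>)"
      proof (rule integral_mono_AE)
        show "integrable (lebesgue_on \<Omega>) (\<lambda>x. (cmod (m x * F k x - m x * f x))\<^sup>2)"
          by (intro L2_integrable L2_diff L2_bounded_mult[OF _ m C] L)
        show "integrable (lebesgue_on \<Omega>) (\<lambda>x. C\<^sup>2 * (cmod (F k x - f x))\<^sup>2)"
          using L2_integrable[OF L2_diff[OF L]] by simp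
        show "AE x in lebesgue_on \<Omega>. (cmod (m x * F k x - m x * f x))\<^sup>2 \<le> C\<^sup>2 * (cmod (F k x - f x))\<^sup>2"
          using C
        proof eventually_elim
          case (elim x)
          have "(cmod (m x))\<^sup>2 \<le> C\<^sup>2" using elim by (intro power_mono) auto
          then show ?case
            by (simp add: norm_mult power_mult_distrib mult_right_mono flip: right_diff_distrib)
        qed
      qed
      then show "(\<integral>x. (cmod (m x * F k x - m x * f x))\<^sup>2 \<partial>lebesgue_on \<Omega>)
        \<le> C\<^sup>2 * (\<integral>x. (cmod (F k x - f x))\<^sup>2 \<partial>lebesgue_on \<Omega>)" by simp
    qed
  qed simp
  then show ?thesis using L2_bounded_mult[OF L(1) m C] L2_bounded_mult[OF L(2) m C]
    by (simp add: L2_lim_def)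
qed

text \<open>The square of a sum is at most twice the sum of the squares, which avoids the triangle
  inequality for the L2 norm.\<close>

lemma L2_lim_diff:
  assumes F: "L2_lim \<Omega> F f" and G: "L2_lim \<Omega> G g"
  shows "L2_lim \<Omega> (\<lambda>k x. F k x - G k x) (\<lambda>x. f x - g x)"
proof -
  have L: "L2 \<Omega> (F k)" "L2 \<Omega> f" "L2 \<Omega> (G k)" "L2 \<Omega> g" for k
    using F G by (auto simp: L2_lim_def)
  let ?I = "\<lambda>F f k. \<integral>x. (cmod (F k x - f x))\<^sup>2 \<partial>lebesgue_on \<Omega>"
  have D: "(\<lambda>k. 2 * ?I F f k + 2 * ?I G g k) \<longlonglongrightarrow> 2 * 0 + 2 * 0"
    using F G by (intro tendsto_intros) (auto simp: L2_lim_def)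
  have "(\<lambda>k. \<integral>x. (cmod (F k x - G k x - (f x - g x)))\<^sup>2 \<partial>lebesgue_on \<Omega>) \<longlonglongrightarrow> 0"
  proof (rule tendsto_sandwich[OF _ _ tendsto_const])
    show "(\<lambda>k. 2 * ?I F f k + 2 * ?I G g k) \<longlonglongrightarrow> 0" using D by simp
    show "\<forall>\<^sub>F k in sequentially. (\<integral>x. (cmod (F k x - G k x - (f x - g x)))\<^sup>2 \<partial>lebesgue_on \<Omega>)
        \<le> 2 * ?I F f k + 2 * ?I G g k"
    proof (rule always_eventually, rule allI)
      fix k
      have i: "integrable (lebesgue_on \<Omega>) (\<lambda>x. (cmod (F k x - f x))\<^sup>2)"
        "integrable (lebesgue_on \<Omega>) (\<lambda>x. (cmod (G k x - g x))\<^sup>2)"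
        by (intro L2_integrable L2_diff L)+
      have "(\<integral>x. (cmod (F k x - G k x - (f x - g x)))\<^sup>2 \<partial>lebesgue_on \<Omega>)
          \<le> (\<integral>x. 2 * (cmod (F k x - f x))\<^sup>2 + 2 * (cmod (G k x - g x))\<^sup>2 \<partial>lebesgue_on \<Omega>)"
      proof (rule integral_mono)
        show "integrable (lebesgue_on \<Omega>) (\<lambda>x. (cmod (F k x - G k x - (f x - g x)))\<^sup>2)"
          by (intro L2_integrable L2_diff L)
        fix x
        have "cmod (F k x - G k x - (f x - g x)) \<le> cmod (F k x - f x) + cmod (G k x - g x)"
          using norm_triangle_ineq4[of "F k x - f x" "G k x - g x"] by (simp add: algebra_simps)
        then have "(cmod (F k x - G k x - (f x - g x)))\<^sup>2 \<le> (cmod (F k x - f x) + cmod (G k x - g x))\<^sup>2"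
          by (intro power_mono) auto
        also have "\<dots> \<le> 2 * (cmod (F k x - f x))\<^sup>2 + 2 * (cmod (G k x - g x))\<^sup>2"
          using sum_squares_bound[of "cmod (F k x - f x)" "cmod (G k x - g x)"]
          by (simp add: power2_sum)
        finally show "(cmod (F k x - G k x - (f x - g x)))\<^sup>2
          \<le> 2 * (cmod (F k x - f x))\<^sup>2 + 2 * (cmod (G k x - g x))\<^sup>2" .
      qed (use i in simp)
      also have "\<dots> = 2 * ?I F f k + 2 * ?I G g k" using i by simp
      finally show "(\<integral>x. (cmod (F k x - G k x - (f x - g x)))\<^sup>2 \<partial>lebesgue_on \<Omega>)
        \<le> 2 * ?I F f k + 2 * ?I G g k" .
    qed
  qed simp
  then show ?thesis using L by (simp add: L2_lim_def L2_diff)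
qed

text \<open>With \<open>dF = F - f\<close> and \<open>dG = G - g\<close> one has
  \<open>F * G - f * g = dF * dG + dF * g + f * dG\<close>, and Cauchy-Schwarz makes each term
  small. The pairing is bilinear; conjugates are inserted by \<open>L2_lim_cnj\<close> where they
  are wanted.\<close>

lemma L2_lim_integral_mult:
  assumes F: "L2_lim \<Omega> F f" and G: "L2_lim \<Omega> G g"
  shows "(\<lambda>k. \<integral>x. F k x * G k x \<partial>lebesgue_on \<Omega>) \<longlonglongrightarrow> (\<integral>x. f x * g x \<partial>lebesgue_on \<Omega>)"
proof -
  have L: "L2 \<Omega> (F k)" "L2 \<Omega> f" "L2 \<Omega> (G k)" "L2 \<Omega> g" for k
    using F G by (auto simp: L2_lim_def)
  define N where "N = (\<lambda>h. sqrt (\<integral>x. (cmod (h x))\<^sup>2 \<partial>lebesgue_on \<Omega>))"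
  have NF: "(\<lambda>k. N (\<lambda>x. F k x - f x)) \<longlonglongrightarrow> 0"
    using F tendsto_real_sqrt[of _ 0] by (fastforce simp: L2_lim_def N_def)
  have NG: "(\<lambda>k. N (\<lambda>x. G k x - g x)) \<longlonglongrightarrow> 0"
    using G tendsto_real_sqrt[of _ 0] by (fastforce simp: L2_lim_def N_def)
  have bound: "cmod ((\<integral>x. F k x * G k x \<partial>lebesgue_on \<Omega>) - (\<integral>x. f x * g x \<partial>lebesgue_on \<Omega>))
      \<le> N (\<lambda>x. F k x - f x) * N (\<lambda>x. G k x - g x) + N (\<lambda>x. F k x - f x) * N g
        + N f * N (\<lambda>x. G k x - g x)" for k
  proof -
    let ?df = "\<lambda>x. F k x - f x" and ?dg = "\<lambda>x. G k x - g x"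
    have df: "L2 \<Omega> ?df" and dg: "L2 \<Omega> ?dg" by (intro L2_diff L)+
    note i = L2_mult_integrable
    have "(\<integral>x. F k x * G k x \<partial>lebesgue_on \<Omega>) - (\<integral>x. f x * g x \<partial>lebesgue_on \<Omega>)
       = (\<integral>x. F k x * G k x - f x * g x \<partial>lebesgue_on \<Omega>)"
      using i[OF L(1) L(3)] i[OF L(2) L(4)] by simp
    also have "\<dots> = (\<integral>x. ?df x * ?dg x + ?df x * g x + f x * ?dg x \<partial>lebesgue_on \<Omega>)"
      by (rule Bochner_Integration.integral_cong) (auto simp: algebra_simps)
    also have "\<dots> = (\<integral>x. ?df x * ?dg x \<partial>lebesgue_on \<Omega>) + (\<integral>x. ?df x * g x \<partial>lebesgue_on \<Omega>)
        + (\<integral>x. f x * ?dg x \<partial>lebesgue_on \<Omega>)"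
      using i[OF df dg] i[OF df L(4)] i[OF L(2) dg]
      by (subst Bochner_Integration.integral_add, simp_all add: Bochner_Integration.integral_add
          del: Bochner_Integration.integral_diff)
    finally have e: "(\<integral>x. F k x * G k x \<partial>lebesgue_on \<Omega>) - (\<integral>x. f x * g x \<partial>lebesgue_on \<Omega>)
      = (\<integral>x. ?df x * ?dg x \<partial>lebesgue_on \<Omega>) + (\<integral>x. ?df x * g x \<partial>lebesgue_on \<Omega>)
        + (\<integral>x. f x * ?dg x \<partial>lebesgue_on \<Omega>)" .
    show ?thesis unfolding e
      using L2_Cauchy_Schwarz[OF df dg] L2_Cauchy_Schwarz[OF df L(4)] L2_Cauchy_Schwarz[OF L(2) dg]
      unfolding N_def by (intro order_trans[OF norm_triangle_ineq] add_mono)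
  qed
  have "(\<lambda>k. N (\<lambda>x. F k x - f x) * N (\<lambda>x. G k x - g x) + N (\<lambda>x. F k x - f x) * N g
        + N f * N (\<lambda>x. G k x - g x)) \<longlonglongrightarrow> 0 * 0 + 0 * N g + N f * 0"
    by (intro tendsto_add tendsto_mult tendsto_const NF NG)
  then have lim: "(\<lambda>k. N (\<lambda>x. F k x - f x) * N (\<lambda>x. G k x - g x) + N (\<lambda>x. F k x - f x) * N g
        + N f * N (\<lambda>x. G k x - g x)) \<longlonglongrightarrow> 0" by simp
  have "(\<lambda>k. (\<integral>x. F k x * G k x \<partial>lebesgue_on \<Omega>) - (\<integral>x. f x * g x \<partial>lebesgue_on \<Omega>)) \<longlonglongrightarrow> 0"
    by (rule Lim_null_comparison[OF always_eventually lim]) (rule allI, rule bound)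
  then show ?thesis by (simp add: LIM_zero_iff)
qed

section \<open>Integration by parts\<close>

lemma L2_test_fun:
  fixes \<phi> :: "real^'n::finite \<Rightarrow> complex"
  assumes \<Omega>: "\<Omega> \<in> sets lebesgue" and \<phi>: "\<phi> \<in> test_fun \<Omega>"
  shows "L2 \<Omega> \<phi>"
proof -
  let ?S = "closure {x. \<phi> x \<noteq> 0}"
  have cont: "continuous_on S \<phi>" for S by (rule smooth_fun_continuous[OF test_fun_smooth[OF \<phi>]])
  have "integrable lborel (\<lambda>x. indicator ?S x *\<^sub>R (cmod (\<phi> x))\<^sup>2)"
    by (intro borel_integrable_compact test_fun_compact_support(1)[OF \<phi>] continuous_intros cont)
  moreover have "(\<lambda>x. indicator ?S x *\<^sub>R (cmod (\<phi> x))\<^sup>2) = (\<lambda>x. (cmod (\<phi> x))\<^sup>2)"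
    using closure_subset[of "{x. \<phi> x \<noteq> 0}"] by (auto simp: indicator_def fun_eq_iff)
  ultimately have "integrable lborel (\<lambda>x. (cmod (\<phi> x))\<^sup>2)" by simp
  then have "integrable lebesgue (\<lambda>x. (cmod (\<phi> x))\<^sup>2)"
    by (subst integrable_completion) auto
  then have "integrable (lebesgue_on \<Omega>) (\<lambda>x. (cmod (\<phi> x))\<^sup>2)"
    using integrable_mult_indicator[OF \<Omega>, of "\<lambda>x. (cmod (\<phi> x))\<^sup>2"] \<Omega>
    by (simp add: integrable_restrict_space)
  then show ?thesis using continuous_lebesgue_measurable[OF cont] by (simp add: L2_def)
qed

text \<open>The representative chosen by \<open>wgrad\<close> agrees almost everywhere with the
  square integrable witness of \<open>H1\<close>, and so inherits its integrability.\<close>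

lemma H1_wgrad:
  assumes \<Omega>: "open \<Omega>" and u: "u \<in> H1 \<Omega>"
  shows "weak_grad \<Omega> u (wgrad \<Omega> u)" "L2v \<Omega> (wgrad \<Omega> u)"
proof -
  obtain g where g: "L2v \<Omega> g" "weak_grad \<Omega> u g" using u by (auto simp: H1_def)
  show w: "weak_grad \<Omega> u (wgrad \<Omega> u)" by (rule weak_grad_wgrad[OF g(2)])
  have "AE x in lebesgue_on \<Omega>. g x = wgrad \<Omega> u x" by (rule weak_grad_unique[OF \<Omega> g(2) w])
  then have "AE x in lebesgue_on \<Omega>. g x $ i = wgrad \<Omega> u x $ i" for i
    by eventually_elim simp
  with g(1) \<Omega> show "L2v \<Omega> (wgrad \<Omega> u)"
    unfolding L2v_def using L2_AE_cong[of \<Omega>] by fastforce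
qed

lemma Hdiv_wdiv:
  assumes \<Omega>: "open \<Omega>" and q: "q \<in> Hdiv \<Omega>"
  shows "weak_div \<Omega> q (wdiv \<Omega> q)" "L2 \<Omega> (wdiv \<Omega> q)"
proof -
  obtain w where w: "L2 \<Omega> w" "weak_div \<Omega> q w" using q by (auto simp: Hdiv_def)
  show d: "weak_div \<Omega> q (wdiv \<Omega> q)" by (rule weak_div_wdiv[OF w(2)])
  show "L2 \<Omega> (wdiv \<Omega> q)"
    by (rule L2_AE_cong[OF _ w(1) weak_div_unique[OF \<Omega> w(2) d]]) (use \<Omega> in simp)
qed

section \<open>Approximation by test functions and passage to the limit\<close>

text \<open>Making the gradient an argument frees the approximation from the choice in
  \<open>wgrad\<close>: a difference of functions is paired with the difference of the gradients by
  subtracting the approximating sequences.\<close>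

definition H10_pair :: "(real^'n::finite) set \<Rightarrow> (real^'n \<Rightarrow> complex) \<Rightarrow> (real^'n \<Rightarrow> complex^'n) \<Rightarrow> bool"
  where "H10_pair \<Omega> u g \<longleftrightarrow> (\<exists>\<phi>. (\<forall>k. \<phi> k \<in> test_fun \<Omega>) \<and> L2_lim \<Omega> \<phi> u
    \<and> (\<forall>i. L2_lim \<Omega> (\<lambda>k. pderiv_i i (\<phi> k)) (\<lambda>x. g x $ i)))"

lemma H10_pair_L2:
  assumes "H10_pair \<Omega> u g"
  shows "L2 \<Omega> u" "L2 \<Omega> (\<lambda>x. g x $ i)"
  using assms by (auto simp: H10_pair_def L2_lim_def)

lemma H10_pair_diff:
  assumes "H10_pair \<Omega> u g" "H10_pair \<Omega> v h"
  shows "H10_pair \<Omega> (\<lambda>x. u x - v x) (\<lambda>x. g x - h x)"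
proof -
  obtain \<phi> \<psi> where \<phi>: "\<And>k. \<phi> k \<in> test_fun \<Omega>" "L2_lim \<Omega> \<phi> u"
      "\<And>i. L2_lim \<Omega> (\<lambda>k. pderiv_i i (\<phi> k)) (\<lambda>x. g x $ i)"
    and \<psi>: "\<And>k. \<psi> k \<in> test_fun \<Omega>" "L2_lim \<Omega> \<psi> v"
      "\<And>i. L2_lim \<Omega> (\<lambda>k. pderiv_i i (\<psi> k)) (\<lambda>x. h x $ i)"
    using assms unfolding H10_pair_def by metis
  have "pderiv_i i (\<lambda>x. \<phi> k x - \<psi> k x) = (\<lambda>x. pderiv_i i (\<phi> k) x - pderiv_i i (\<psi> k) x)" for i k
    by (intro ext pderiv_i_diff smooth_fun_differentiable test_fun_smooth[OF \<phi>(1)] test_fun_smooth[OF \<psi>(1)])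
  then show ?thesis unfolding H10_pair_def
    using test_fun_diff[OF \<phi>(1) \<psi>(1)] L2_lim_diff[OF \<phi>(2) \<psi>(2)] L2_lim_diff[OF \<phi>(3) \<psi>(3)]
    by (intro exI[of _ "\<lambda>k x. \<phi> k x - \<psi> k x"]) simp
qed

text \<open>The sum that tends to zero in \<open>H10\<close> consists of nonnegative terms, so both
  do; a single gradient component is dominated by the norm of the whole vector.\<close>

lemma H10_imp_pair:
  fixes \<Omega> :: "(real^'n::finite) set"
  assumes \<Omega>: "open \<Omega>" and u: "u \<in> H10 \<Omega>"
  shows "H10_pair \<Omega> u (wgrad \<Omega> u)"
proof -
  have \<Omega>': "\<Omega> \<in> sets lebesgue" using \<Omega> by simp
  obtain \<phi> where u1: "u \<in> H1 \<Omega>" and \<phi>: "\<And>k. \<phi> k \<in> test_fun \<Omega>"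
    and lim: "(\<lambda>k. (\<integral>x. (cmod (u x - \<phi> k x))\<^sup>2 \<partial>lebesgue_on \<Omega>)
         + (\<integral>x. (norm (wgrad \<Omega> u x - cgrad (\<phi> k) x))\<^sup>2 \<partial>lebesgue_on \<Omega>)) \<longlonglongrightarrow> 0"
    using u unfolding H10_def by blast
  have Lu: "L2 \<Omega> u" using u1 by (simp add: H1_def)
  have Lg: "L2 \<Omega> (\<lambda>x. wgrad \<Omega> u x $ i)" for i
    using H1_wgrad(2)[OF \<Omega> u1] by (simp add: L2v_def)
  have L\<phi>: "L2 \<Omega> (\<phi> k)" "L2 \<Omega> (pderiv_i i (\<phi> k))" for k i
    by (intro L2_test_fun[OF \<Omega>'] test_fun_pderiv \<phi>)+
  have n: "(norm (v - w))\<^sup>2 = (\<Sum>i\<in>UNIV. (cmod (v $ i - w $ i))\<^sup>2)" for v w :: "complex^'n"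
    by (simp add: norm_vec_def L2_set_def sum_nonneg)
  have int: "integrable (lebesgue_on \<Omega>) (\<lambda>x. (cmod (wgrad \<Omega> u x $ i - pderiv_i i (\<phi> k) x))\<^sup>2)" for i k
    by (intro L2_integrable L2_diff Lg L\<phi>)
  let ?T = "\<lambda>k. \<integral>x. (norm (wgrad \<Omega> u x - cgrad (\<phi> k) x))\<^sup>2 \<partial>lebesgue_on \<Omega>"
  let ?G = "\<lambda>i k. \<integral>x. (cmod (pderiv_i i (\<phi> k) x - wgrad \<Omega> u x $ i))\<^sup>2 \<partial>lebesgue_on \<Omega>"
  have G: "?G i k \<le> ?T k" for i k
    unfolding n cgrad_def
  proof (rule integral_mono)
    fix x
    show "(cmod (pderiv_i i (\<phi> k) x - wgrad \<Omega> u x $ i))\<^sup>2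
        \<le> (\<Sum>i\<in>UNIV. (cmod (wgrad \<Omega> u x $ i - (\<chi> i. pderiv_i i (\<phi> k) x) $ i))\<^sup>2)"
      using member_le_sum[of i UNIV "\<lambda>i. (cmod (wgrad \<Omega> u x $ i - pderiv_i i (\<phi> k) x))\<^sup>2"]
      by (simp add: norm_minus_commute)
  qed (use int in \<open>auto simp: norm_minus_commute\<close>)
  have "(\<lambda>k. \<integral>x. (cmod (\<phi> k x - u x))\<^sup>2 \<partial>lebesgue_on \<Omega>) \<longlonglongrightarrow> 0"
    by (rule tendsto_sandwich[OF _ _ tendsto_const lim]) (auto simp: norm_minus_commute)
  moreover have "?G i \<longlonglongrightarrow> 0" for i
    by (rule tendsto_sandwich[OF _ _ tendsto_const lim])
       (auto intro!: always_eventually order_trans[OF G])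
  ultimately show ?thesis unfolding H10_pair_def L2_lim_def
    using \<phi> Lu Lg L\<phi> by blast
qed

text \<open>For a test function in place of \<open>e\<close> this is the definition of the weak
  divergence, tested with the conjugate. Both sides are continuous under the convergence in
  \<open>H10_pair\<close>, and the compact supports are why no boundary term arises.\<close>

lemma Green_formula:
  fixes \<Omega> :: "(real^'n::finite) set"
  assumes e: "H10_pair \<Omega> e g" and p: "L2v \<Omega> p" and w: "L2 \<Omega> w" "weak_div \<Omega> p w"
  shows "(\<Sum>i\<in>UNIV. \<integral>x. p x $ i * cnj (g x $ i) \<partial>lebesgue_on \<Omega>)
     = - (\<integral>x. w x * cnj (e x) \<partial>lebesgue_on \<Omega>)"
proof -
  obtain \<phi> where \<phi>: "\<And>k. \<phi> k \<in> test_fun \<Omega>" "L2_lim \<Omega> \<phi> e"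
      "\<And>i. L2_lim \<Omega> (\<lambda>k. pderiv_i i (\<phi> k)) (\<lambda>x. g x $ i)"
    using e unfolding H10_pair_def by metis
  have pi: "L2 \<Omega> (\<lambda>x. p x $ i)" for i using p by (simp add: L2v_def)
  have L: "L2 \<Omega> (\<lambda>x. cnj (pderiv_i i (\<phi> k) x))" for i k
    using \<phi>(3) by (intro L2_cnj) (simp add: L2_lim_def)
  have eq: "(\<Sum>i\<in>UNIV. \<integral>x. p x $ i * cnj (pderiv_i i (\<phi> k) x) \<partial>lebesgue_on \<Omega>)
     = - (\<integral>x. w x * cnj (\<phi> k x) \<partial>lebesgue_on \<Omega>)" for k
  proof -
    have "pderiv_i i (\<lambda>x. cnj (\<phi> k x)) x = cnj (pderiv_i i (\<phi> k) x)" for i x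
      by (intro pderiv_i_cnj smooth_fun_differentiable test_fun_smooth[OF \<phi>(1)])
    then show ?thesis
      using w(2) test_fun_cnj[OF \<phi>(1)[of k]] L2_mult_integrable[OF pi L]
      by (auto simp: weak_div_def)
  qed
  have "(\<lambda>k. \<Sum>i\<in>UNIV. \<integral>x. p x $ i * cnj (pderiv_i i (\<phi> k) x) \<partial>lebesgue_on \<Omega>)
    \<longlonglongrightarrow> (\<Sum>i\<in>UNIV. \<integral>x. p x $ i * cnj (g x $ i) \<partial>lebesgue_on \<Omega>)"
    by (intro tendsto_sum L2_lim_integral_mult L2_lim_const pi L2_lim_cnj \<phi>(3))
  moreover have "(\<lambda>k. - (\<integral>x. w x * cnj (\<phi> k x) \<partial>lebesgue_on \<Omega>))
    \<longlonglongrightarrow> - (\<integral>x. w x * cnj (e x) \<partial>lebesgue_on \<Omega>)"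
    by (intro tendsto_minus L2_lim_integral_mult L2_lim_const w L2_lim_cnj \<phi>(2))
  ultimately show ?thesis unfolding eq by (rule LIMSEQ_unique)
qed

text \<open>Test the weak divergence of \<open>\<beta>\<close> with \<open>\<bar>\<phi>\<bar>\<^sup>2\<close>, where \<open>\<phi>\<close> approximates \<open>e\<close>.\<close>

lemma convection_identity:
  fixes \<Omega> :: "(real^'n::finite) set"
  assumes e: "H10_pair \<Omega> e g"
    and b: "\<beta> \<in> borel_measurable (lebesgue_on \<Omega>)" "AE x in lebesgue_on \<Omega>. norm (\<beta> x) \<le> B"
    and d: "\<delta> \<in> borel_measurable (lebesgue_on \<Omega>)" "AE x in lebesgue_on \<Omega>. cmod (\<delta> x) \<le> D"
    and div: "weak_div \<Omega> \<beta> \<delta>"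
  shows "(\<Sum>i\<in>UNIV. (\<integral>x. \<beta> x $ i * e x * cnj (g x $ i) \<partial>lebesgue_on \<Omega>)
        + (\<integral>x. \<beta> x $ i * g x $ i * cnj (e x) \<partial>lebesgue_on \<Omega>))
     = - (\<integral>x. \<delta> x * e x * cnj (e x) \<partial>lebesgue_on \<Omega>)"
proof -
  obtain \<phi> where \<phi>: "\<And>k. \<phi> k \<in> test_fun \<Omega>" "L2_lim \<Omega> \<phi> e"
      "\<And>i. L2_lim \<Omega> (\<lambda>k. pderiv_i i (\<phi> k)) (\<lambda>x. g x $ i)"
    using e unfolding H10_pair_def by metis
  have bi: "(\<lambda>x. \<beta> x $ i) \<in> borel_measurable (lebesgue_on \<Omega>)" for i
    by (rule borel_measurable_continuous_on[OF _ b(1)]) (intro continuous_intros)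
  have Bi: "AE x in lebesgue_on \<Omega>. cmod (\<beta> x $ i) \<le> B" for i
    using b(2) by eventually_elim (rule order_trans[OF Finite_Cartesian_Product.norm_nth_le])
  \<comment> \<open>The bounded coefficients are absorbed into one factor, so that every triple
    product becomes a product of two sequences converging in square mean.\<close>
  have l1: "L2_lim \<Omega> (\<lambda>k x. \<beta> x $ i * \<phi> k x) (\<lambda>x. \<beta> x $ i * e x)"
    and l2: "L2_lim \<Omega> (\<lambda>k x. \<beta> x $ i * pderiv_i i (\<phi> k) x) (\<lambda>x. \<beta> x $ i * g x $ i)"
    and l3: "L2_lim \<Omega> (\<lambda>k x. \<delta> x * \<phi> k x) (\<lambda>x. \<delta> x * e x)" for i
    by (intro L2_lim_bounded_mult[OF _ bi Bi] L2_lim_bounded_mult[OF _ d] \<phi>)+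
  note c1 = L2_lim_cnj[OF \<phi>(3)] and c2 = L2_lim_cnj[OF \<phi>(2)]
  have I: "integrable (lebesgue_on \<Omega>) (\<lambda>x. \<beta> x $ i * \<phi> k x * cnj (pderiv_i i (\<phi> k) x))"
    "integrable (lebesgue_on \<Omega>) (\<lambda>x. \<beta> x $ i * pderiv_i i (\<phi> k) x * cnj (\<phi> k x))" for i k
    using l1 l2 c1 c2 by (auto intro!: L2_mult_integrable simp: L2_lim_def)
  have eq: "(\<Sum>i\<in>UNIV. (\<integral>x. \<beta> x $ i * \<phi> k x * cnj (pderiv_i i (\<phi> k) x) \<partial>lebesgue_on \<Omega>)
        + (\<integral>x. \<beta> x $ i * pderiv_i i (\<phi> k) x * cnj (\<phi> k x) \<partial>lebesgue_on \<Omega>))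
     = - (\<integral>x. \<delta> x * \<phi> k x * cnj (\<phi> k x) \<partial>lebesgue_on \<Omega>)" for k
  proof -
    have t: "(\<lambda>x. \<phi> k x * cnj (\<phi> k x)) \<in> test_fun \<Omega>"
      by (intro test_fun_mult \<phi>(1) smooth_fun_cnj test_fun_smooth[OF \<phi>(1)])
    have df: "\<phi> k differentiable (at x)" for x
      by (intro smooth_fun_differentiable test_fun_smooth[OF \<phi>(1)])
    have pd: "\<beta> x $ i * pderiv_i i (\<lambda>x. \<phi> k x * cnj (\<phi> k x)) x
        = \<beta> x $ i * \<phi> k x * cnj (pderiv_i i (\<phi> k) x) + \<beta> x $ i * pderiv_i i (\<phi> k) x * cnj (\<phi> k x)"
      for i x
      using df by (subst pderiv_i_mult) (auto simp: pderiv_i_cnj differentiable_cnj_iff algebra_simps)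
    have "(\<integral>x. (\<Sum>i\<in>UNIV. \<beta> x $ i * \<phi> k x * cnj (pderiv_i i (\<phi> k) x)
          + \<beta> x $ i * pderiv_i i (\<phi> k) x * cnj (\<phi> k x)) \<partial>lebesgue_on \<Omega>)
        = - (\<integral>x. \<delta> x * (\<phi> k x * cnj (\<phi> k x)) \<partial>lebesgue_on \<Omega>)"
      using bspec[OF div[unfolded weak_div_def] t] unfolding pd by blast
    then show ?thesis using I by (simp add: mult.assoc)
  qed
  have "(\<lambda>k. \<Sum>i\<in>UNIV. (\<integral>x. \<beta> x $ i * \<phi> k x * cnj (pderiv_i i (\<phi> k) x) \<partial>lebesgue_on \<Omega>)
        + (\<integral>x. \<beta> x $ i * pderiv_i i (\<phi> k) x * cnj (\<phi> k x) \<partial>lebesgue_on \<Omega>))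
    \<longlonglongrightarrow> (\<Sum>i\<in>UNIV. (\<integral>x. \<beta> x $ i * e x * cnj (g x $ i) \<partial>lebesgue_on \<Omega>)
        + (\<integral>x. \<beta> x $ i * g x $ i * cnj (e x) \<partial>lebesgue_on \<Omega>))"
    by (intro tendsto_sum tendsto_add L2_lim_integral_mult l1 l2 c1 c2)
  moreover have "(\<lambda>k. - (\<integral>x. \<delta> x * \<phi> k x * cnj (\<phi> k x) \<partial>lebesgue_on \<Omega>))
    \<longlonglongrightarrow> - (\<integral>x. \<delta> x * e x * cnj (e x) \<partial>lebesgue_on \<Omega>)"
    by (intro tendsto_minus L2_lim_integral_mult l3 c2)
  ultimately show ?thesis unfolding eq by (rule LIMSEQ_unique)
qed

section \<open>Elliptic matrix fields\<close>

lemma cinner_simps: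
  "cinner (u + v) w = cinner u w + cinner v w" "cinner w (u + v) = cinner w u + cinner w v"
  "cinner (u - v) w = cinner u w - cinner v w" "cinner w (u - v) = cinner w u - cinner w v"
  by (simp_all add: cinner_def algebra_simps sum.distrib sum_subtractf)

lemma cinner_cnj: "cinner v w = cnj (cinner w v)"
  by (simp add: cinner_def mult.commute)

lemma cinner_self: "cinner v v = complex_of_real ((norm v)\<^sup>2)"
  by (simp add: cinner_def norm_vec_def L2_set_def sum_nonneg complex_norm_square[symmetric])

lemma cinner_Cauchy_Schwarz: "cmod (cinner v w) \<le> norm v * norm w"
proof -
  have "cmod (cinner v w) \<le> (\<Sum>i\<in>UNIV. \<bar>cmod (v $ i)\<bar> * \<bar>cmod (w $ i)\<bar>)"
    unfolding cinner_def by (rule sum_norm_le) (simp add: norm_mult)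
  also have "\<dots> \<le> norm v * norm w"
    unfolding norm_vec_def by (rule L2_set_mult_ineq)
  finally show ?thesis .
qed

lemma cinner_hermitian:
  assumes "\<forall>i j. M $ i $ j = cnj (M $ j $ i)"
  shows "cinner (M *v v) w = cinner v (M *v w)"
proof -
  have "cinner (M *v v) w = (\<Sum>i\<in>UNIV. \<Sum>j\<in>UNIV. M $ i $ j * v $ j * cnj (w $ i))"
    by (simp add: cinner_def matrix_vector_mult_def sum_distrib_right)
  also have "\<dots> = (\<Sum>j\<in>UNIV. \<Sum>i\<in>UNIV. M $ i $ j * v $ j * cnj (w $ i))"
    by (rule sum.swap)
  also have "\<dots> = (\<Sum>j\<in>UNIV. \<Sum>i\<in>UNIV. cnj (M $ j $ i) * v $ j * cnj (w $ i))"
    using assms by (metis (no_types, lifting) sum.cong)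
  also have "\<dots> = cinner v (M *v w)"
    by (simp add: cinner_def matrix_vector_mult_def sum_distrib_left mult_ac)
  finally show ?thesis .
qed

definition elliptic :: "real \<Rightarrow> complex^'n::finite^'n \<Rightarrow> bool" where
  "elliptic \<alpha> M \<longleftrightarrow> (\<forall>v. \<alpha> * (norm v)\<^sup>2 \<le> Re (cinner (M *v v) v))"

text \<open>Cauchy-Schwarz turns coercivity into a lower bound for the image. It yields both the
  trivial kernel of \<open>M\<close> and the bound \<open>1 / \<alpha>\<close> for its
  inverse.\<close>

lemma elliptic_norm:
  assumes "elliptic \<alpha> M"
  shows "\<alpha> * norm v \<le> norm (M *v v)"
proof (cases "norm v = 0")
  case False
  have "\<alpha> * (norm v)\<^sup>2 \<le> norm (M *v v) * norm v"
    using assms cinner_Cauchy_Schwarz[of "M *v v" v] complex_Re_le_cmod[of "cinner (M *v v) v"]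
    unfolding elliptic_def by (meson order_trans)
  then show ?thesis using False by (simp add: power2_eq_square)
qed simp

lemma elliptic_invertible:
  assumes "elliptic \<alpha> M" "\<alpha> > 0"
  shows "invertible M"
proof -
  have "v = 0" if "M *v v = 0" for v
    using elliptic_norm[OF assms(1), of v] assms(2) that by (simp add: mult_le_0_iff)
  then show ?thesis
    unfolding invertible_left_inverse matrix_left_invertible_ker by blast
qed

lemma invertible_matrix_inv:
  assumes "invertible M"
  shows "M ** matrix_inv M = mat 1" "matrix_inv M ** M = mat 1"
  using someI_ex[OF assms[unfolded invertible_def]] unfolding matrix_inv_def by auto

lemma matrix_inv_vector:
  assumes "invertible (M :: 'a::field^'n^'n)"
  shows "M *v (matrix_inv M *v y) = y" "matrix_inv M *v (M *v y) = y"
  using invertible_matrix_inv[OF assms] by (simp_all add: matrix_vector_mul_assoc)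

text \<open>The left factor is the inverse of \<open>M\<close> applied to the right one. In the
  weight given by the inverse, the mixed terms are \<open>cinner y g\<close> and its conjugate, in
  which \<open>M\<close> no longer occurs.\<close>

lemma cinner_residual:
  fixes M :: "complex^'n::finite^'n"
  assumes M: "elliptic \<alpha> M" "\<alpha> > 0" and h: "\<forall>i j. M $ i $ j = cnj (M $ j $ i)"
  shows "Re (cinner (g - matrix_inv M *v y) (M *v g - y))
     = Re (cinner (M *v g) g) - 2 * Re (cinner y g) + Re (cinner (matrix_inv M *v y) y)"
proof -
  have "cinner (matrix_inv M *v y) (M *v g) = cinner y g"
    by (simp add: cinner_hermitian[OF h, symmetric] matrix_inv_vector[OF elliptic_invertible[OF M]])
  moreover have "cinner g (M *v g) = cinner (M *v g) g"
    by (simp add: cinner_hermitian[OF h])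
  moreover have "Re (cinner g y) = Re (cinner y g)"
    by (subst cinner_cnj) simp
  ultimately show ?thesis by (simp add: cinner_simps)
qed

section \<open>Matrix fields acting on square integrable vector fields\<close>

lemma borel_measurable_det:
  fixes M :: "'a \<Rightarrow> complex^'n::finite^'n"
  assumes "\<And>i j. (\<lambda>x. M x $ i $ j) \<in> borel_measurable N"
  shows "(\<lambda>x. det (M x)) \<in> borel_measurable N"
  unfolding det_def by (intro borel_measurable_sum borel_measurable_times borel_measurable_prod assms) simp

lemma Linf_entries:
  fixes A :: "real^'n::finite \<Rightarrow> complex^'n^'n"
  assumes "Linf \<Omega> A"
  obtains C where "\<And>i j. (\<lambda>x. A x $ i $ j) \<in> borel_measurable (lebesgue_on \<Omega>)"
    "\<And>i j. AE x in lebesgue_on \<Omega>. cmod (A x $ i $ j) \<le> C"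
proof -
  obtain C where C: "A \<in> borel_measurable (lebesgue_on \<Omega>)" "AE x in lebesgue_on \<Omega>. norm (A x) \<le> C"
    using assms by (auto simp: Linf_def)
  show ?thesis
  proof
    show "(\<lambda>x. A x $ i $ j) \<in> borel_measurable (lebesgue_on \<Omega>)" for i j
      by (rule borel_measurable_continuous_on[OF _ C(1)]) (intro continuous_intros)
    show "AE x in lebesgue_on \<Omega>. cmod (A x $ i $ j) \<le> C" for i j
      using C(2) by eventually_elim
        (meson Finite_Cartesian_Product.norm_nth_le order_trans)
  qed
qed

lemma L2v_matrix_mult:
  fixes A :: "real^'n::finite \<Rightarrow> complex^'n^'n"
  assumes A: "Linf \<Omega> A" and v: "L2v \<Omega> v"
  shows "L2v \<Omega> (\<lambda>x. A x *v v x)"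
proof -
  obtain C where "\<And>i j. (\<lambda>x. A x $ i $ j) \<in> borel_measurable (lebesgue_on \<Omega>)"
    "\<And>i j. AE x in lebesgue_on \<Omega>. cmod (A x $ i $ j) \<le> C"
    by (rule Linf_entries[OF A]) blast
  then show ?thesis using v
    by (auto simp: L2v_def matrix_vector_mult_def intro!: L2_sum L2_bounded_mult)
qed

lemma L2v_cinner_integrable:
  assumes "L2v \<Omega> v" "L2v \<Omega> w"
  shows "integrable (lebesgue_on \<Omega>) (\<lambda>x. cinner (v x) (w x))"
  using assms unfolding cinner_def L2v_def
  by (intro Bochner_Integration.integrable_sum L2_mult_integrable L2_cnj) auto

text \<open>Cramer's rule makes the solution of \<open>A z = y\<close> visibly measurable.\<close>

lemma L2v_matrix_inv:
  fixes A :: "real^'n::finite \<Rightarrow> complex^'n^'n"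
  assumes \<Omega>: "\<Omega> \<in> sets lebesgue" and A: "Linf \<Omega> A"
    and ell: "AE x in lebesgue_on \<Omega>. elliptic \<alpha> (A x)" and \<alpha>: "\<alpha> > 0"
    and y: "L2v \<Omega> y"
  shows "L2v \<Omega> (\<lambda>x. matrix_inv (A x) *v y x)"
proof -
  have yi: "L2 \<Omega> (\<lambda>x. y x $ i)" for i using y by (simp add: L2v_def)
  note ym[measurable] = L2_measurable[OF yi]
  define z where "z = (\<lambda>x. \<chi> k. det (\<chi> i j. if j = k then y x $ i else A x $ i $ j) / det (A x))"
  obtain C where Am[measurable]: "\<And>i j. (\<lambda>x. A x $ i $ j) \<in> borel_measurable (lebesgue_on \<Omega>)"
    by (rule Linf_entries[OF A]) blast
  have zm: "(\<lambda>x. z x $ i) \<in> borel_measurable (lebesgue_on \<Omega>)" for i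
    unfolding z_def vec_lambda_beta
    by (intro borel_measurable_divide borel_measurable_det) (auto simp: Am ym)
  have zeq: "AE x in lebesgue_on \<Omega>. z x = matrix_inv (A x) *v y x"
    using ell
  proof eventually_elim
    case (elim x)
    have inv: "invertible (A x)" by (rule elliptic_invertible[OF elim \<alpha>])
    then have "det (A x) \<noteq> 0" by (simp add: invertible_det_nz)
    from cramer[OF this, of "matrix_inv (A x) *v y x" "y x"] show ?case
      by (simp add: matrix_inv_vector[OF inv] z_def)
  qed
  \<comment> \<open>The norm of \<open>y\<close>, cast to a complex function, is the majorant for
    \<open>L2_dominated\<close>; the constant \<open>1 / \<alpha>\<close> used with it comes from
    \<open>elliptic_norm\<close> applied to \<open>z x\<close>.\<close>
  have n: "L2 \<Omega> (\<lambda>x. complex_of_real (norm (y x)))"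
  proof -
    have "integrable (lebesgue_on \<Omega>) (\<lambda>x. \<Sum>i\<in>UNIV. (cmod (y x $ i))\<^sup>2)"
      by (intro Bochner_Integration.integrable_sum L2_integrable yi)
    then show ?thesis
      by (simp add: L2_def norm_vec_def L2_set_def sum_nonneg)
  qed
  have "AE x in lebesgue_on \<Omega>. cmod (z x $ i) \<le> (1 / \<alpha>) * cmod (complex_of_real (norm (y x)))" for i
    using ell zeq
  proof eventually_elim
    case (elim x)
    have "\<alpha> * norm (z x) \<le> norm (y x)"
      using elliptic_norm[OF elim(1), of "z x"] matrix_inv_vector(1)[OF elliptic_invertible[OF elim(1) \<alpha>]]
      by (simp add: elim(2))
    then have "norm (z x) \<le> norm (y x) / \<alpha>" using \<alpha> by (simp add: field_simps)
    then show ?case using Finite_Cartesian_Product.norm_nth_le[of "z x" i] by simp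
  qed
  then have zL2: "L2 \<Omega> (\<lambda>x. z x $ i)" for i
    by (rule L2_dominated[OF n zm])
  have zi: "AE x in lebesgue_on \<Omega>. z x $ i = (matrix_inv (A x) *v y x) $ i" for i
    using zeq by eventually_elim simp
  show ?thesis unfolding L2v_def by (rule allI, rule L2_AE_cong[OF \<Omega> zL2 zi])
qed

text \<open>Testing with a constant vector times an indicator makes the integral of the quadratic
  form minus \<open>\<alpha> * (norm v)\<^sup>2\<close> nonnegative over arbitrary bounded
  measurable sets, hence the integrand nonnegative almost everywhere for each fixed
  \<open>v\<close>. The exceptional null set depends on \<open>v\<close>; a countable dense set of
  vectors and continuity in \<open>v\<close> make it uniform.\<close>

lemma elliptic_pointwise:
  fixes A :: "real^'n::finite \<Rightarrow> complex^'n^'n"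
  assumes \<Omega>: "\<Omega> \<in> sets lebesgue" and A: "Linf \<Omega> A"
    and ell: "\<And>\<phi>. L2v \<Omega> \<phi> \<Longrightarrow> \<alpha> * (\<integral>x. (norm (\<phi> x))\<^sup>2 \<partial>lebesgue_on \<Omega>) \<le> wnorm2m \<Omega> A \<phi>"
  shows "AE x in lebesgue_on \<Omega>. elliptic \<alpha> (A x)"
proof -
  let ?M = "lebesgue_on \<Omega>"
  let ?Q = "\<lambda>v M. Re (cinner (M *v v) v) - \<alpha> * (norm v)\<^sup>2"
  let ?B = "\<lambda>n::nat. box (- (real n *\<^sub>R One)) (real n *\<^sub>R One) :: (real^'n) set"
  obtain C where Am[measurable]: "\<And>i j. (\<lambda>x. A x $ i $ j) \<in> borel_measurable ?M"
    and AC: "\<And>i j. AE x in ?M. cmod (A x $ i $ j) \<le> C"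
    by (rule Linf_entries[OF A]) blast
  interpret sigma_finite_measure ?M
    by (rule sigma_finite_measure_restrict_space[OF sigma_finite_lebesgue \<Omega>])
  \<comment> \<open>\<open>\<Omega>\<close> may have infinite measure, and then a constant vector is
    not square integrable; cutting off with the boxes \<open>?B n\<close> repairs this.\<close>
  have fin: "L2 \<Omega> (\<lambda>x. indicator (E \<inter> ?B n) x *\<^sub>R a)" if "E \<in> sets ?M" for E n and a :: complex
  proof -
    have B: "?B n \<inter> \<Omega> \<in> sets ?M" using \<Omega> by (auto simp: sets_restrict_space_iff)
    have "E \<inter> ?B n = E \<inter> (?B n \<inter> \<Omega>)" using sets.sets_into_space[OF that] by auto
    then have E: "E \<inter> ?B n \<in> sets ?M" using sets.Int[OF that B] by metis
    have "emeasure ?M (E \<inter> ?B n) \<le> emeasure ?M (?B n \<inter> \<Omega>)"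
      using sets.sets_into_space[OF that] by (intro emeasure_mono B) auto
    also have "\<dots> = emeasure lebesgue (?B n \<inter> \<Omega>)"
      using \<Omega> by (intro emeasure_restrict_space) auto
    also have "\<dots> \<le> emeasure lebesgue (?B n)" by (intro emeasure_mono) auto
    also have "\<dots> < \<infinity>" by (simp add: emeasure_lborel_box_eq)
    finally have "integrable ?M (\<lambda>x. indicator (E \<inter> ?B n) x *\<^sub>R (cmod a)\<^sup>2)"
      by (intro integrable_scaleR_left integrable_real_indicator E) auto
    moreover have "(cmod (indicator (E \<inter> ?B n) x *\<^sub>R a))\<^sup>2 = indicator (E \<inter> ?B n) x *\<^sub>R (cmod a)\<^sup>2" for x
      by (simp add: indicator_def)
    ultimately show ?thesis
      unfolding L2_def using E by (auto intro!: borel_measurable_scaleR borel_measurable_indicator)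
  qed
  have v: "AE x in ?M. 0 \<le> ?Q v (A x)" for v :: "complex^'n"
  proof -
    have n: "AE x in ?M. 0 \<le> indicator (?B n) x *\<^sub>R ?Q v (A x)" for n
    proof -
      let ?\<phi> = "\<lambda>E x. indicator (E \<inter> ?B n) x *\<^sub>R v"
      have L\<phi>: "L2v \<Omega> (?\<phi> E)" if "E \<in> sets ?M" for E
        using fin[OF that] by (simp add: L2v_def)
      \<comment> \<open>The indicator takes only the values 0 and 1, so it equals its square and can
        be moved into the quadratic form.\<close>
      have scale: "indicator (E \<inter> ?B n) x *\<^sub>R ?Q v M = Re (cinner (M *v ?\<phi> E x) (?\<phi> E x)) - \<alpha> * (norm (?\<phi> E x))\<^sup>2"
        for E x M by (simp add: indicator_def cinner_def)
      have int: "integrable ?M (\<lambda>x. cinner (A x *v ?\<phi> E x) (?\<phi> E x))"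
          "integrable ?M (\<lambda>x. (norm (?\<phi> E x))\<^sup>2)" if "E \<in> sets ?M" for E
      proof -
        show "integrable ?M (\<lambda>x. cinner (A x *v ?\<phi> E x) (?\<phi> E x))"
          by (intro L2v_cinner_integrable L2v_matrix_mult[OF A] L\<phi> that)
        show "integrable ?M (\<lambda>x. (norm (?\<phi> E x))\<^sup>2)"
          using integrable_Re[OF L2v_cinner_integrable[OF L\<phi>[OF that] L\<phi>[OF that]]]
          by (simp only: cinner_self Re_complex_of_real)
      qed
      have eq: "(\<integral>x. indicator (E \<inter> ?B n) x *\<^sub>R ?Q v (A x) \<partial>?M) \<ge> 0" if "E \<in> sets ?M" for E
        unfolding scale
        using int[OF that] ell[OF L\<phi>[OF that]] by (simp add: wnorm2m_def)
      have S: "\<Omega> \<in> sets ?M" using \<Omega> by (simp add: sets_restrict_space_iff)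
      show ?thesis
      proof (rule density_nonneg)
        have "integrable ?M (\<lambda>x. indicator (\<Omega> \<inter> ?B n) x *\<^sub>R ?Q v (A x))"
          unfolding scale by (intro Bochner_Integration.integrable_diff integrable_mult_right integrable_Re int S)
        moreover have "indicator (\<Omega> \<inter> ?B n) x *\<^sub>R ?Q v (A x) = indicator (?B n) x *\<^sub>R ?Q v (A x)"
          if "x \<in> space ?M" for x using that by (simp add: indicator_def)
        ultimately show "integrable ?M (\<lambda>x. indicator (?B n) x *\<^sub>R ?Q v (A x))"
          using Bochner_Integration.integrable_cong[OF refl] by (metis (mono_tags, lifting))
        fix E assume E: "E \<in> sets ?M"
        show "0 \<le> (LINT x:E|?M. indicator (?B n) x *\<^sub>R ?Q v (A x))"
          using eq[OF E] unfolding set_lebesgue_integral_def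
          by (simp add: indicator_inter_arith mult.assoc)
      qed
    qed
    then have "AE x in ?M. \<forall>n. 0 \<le> indicator (?B n) x *\<^sub>R ?Q v (A x)" by (simp add: AE_all_countable)
    then show ?thesis
    proof eventually_elim
      case (elim x)
      have "x \<in> (\<Union>n. ?B n)" by (simp add: UN_box_eq_UNIV)
      then obtain n where "x \<in> ?B n" by blast
      with spec[OF elim, of n] show ?case by simp
    qed
  qed
  obtain D :: "(complex^'n) set" where D: "countable D" "\<And>X. open X \<Longrightarrow> X \<noteq> {} \<Longrightarrow> \<exists>d\<in>D. d \<in> X"
    by (rule countable_dense_setE) blast
  have "AE x in ?M. \<forall>v\<in>D. 0 \<le> ?Q v (A x)"
    unfolding AE_ball_countable[OF D(1)] using v by blast
  then show ?thesis
  proof eventually_elim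
    case (elim x)
    have "continuous_on UNIV (\<lambda>v. ?Q v (A x))"
      unfolding cinner_def matrix_vector_mult_def vec_lambda_beta by (intro continuous_intros)
    \<comment> \<open>If this open set of bad vectors were nonempty, it would contain a member of
      the dense set \<open>D\<close>.\<close>
    then have "open {v. ?Q v (A x) < 0}"
      by (intro open_Collect_less continuous_on_const)
    with D(2) elim have "{v. ?Q v (A x) < 0} = {}" by fastforce
    then show ?case by (auto simp: elliptic_def not_less)
  qed
qed

section \<open>The error identity\<close>

text \<open>Completeness supplies the measurability of \<open>g\<close>, so only one side has to be
  checked. This matters for integrands containing \<open>matrix_inv\<close> or a chosen
  derivative.\<close>

lemma lebesgue_on_integral_AE_cong:
  fixes f g :: "real^'n::finite \<Rightarrow> 'b::euclidean_space"
  assumes "\<Omega> \<in> sets lebesgue" "f \<in> borel_measurable (lebesgue_on \<Omega>)"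
    "AE x in lebesgue_on \<Omega>. f x = g x"
  shows "(\<integral>x. f x \<partial>lebesgue_on \<Omega>) = (\<integral>x. g x \<partial>lebesgue_on \<Omega>)"
  using lebesgue_on_measurable_AE[OF assms] assms by (intro integral_cong_AE)

lemma wnorm2_AE_cong:
  assumes \<Omega>: "\<Omega> \<in> sets lebesgue" and "\<gamma> \<in> borel_measurable (lebesgue_on \<Omega>)" "L2 \<Omega> v"
    and ae: "AE x in lebesgue_on \<Omega>. v x = v' x"
  shows "wnorm2 \<Omega> \<gamma> v = wnorm2 \<Omega> \<gamma> v'"
proof -
  note [measurable] = assms(2) L2_measurable[OF assms(3)]
  show ?thesis unfolding wnorm2_def
    by (rule lebesgue_on_integral_AE_cong[OF \<Omega>])
       (measurable, use ae in \<open>auto elim: eventually_mono\<close>)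
qed

lemma wnorm2m_AE_cong:
  assumes \<Omega>: "\<Omega> \<in> sets lebesgue" and v: "L2v \<Omega> v" "L2v \<Omega> (\<lambda>x. M x *v v x)"
    and ae: "AE x in lebesgue_on \<Omega>. v x = v' x"
  shows "wnorm2m \<Omega> M v = wnorm2m \<Omega> M v'"
proof -
  have "(\<integral>x. cinner (M x *v v x) (v x) \<partial>lebesgue_on \<Omega>) = (\<integral>x. cinner (M x *v v' x) (v' x) \<partial>lebesgue_on \<Omega>)"
    by (rule lebesgue_on_integral_AE_cong[OF \<Omega> borel_measurable_integrable[OF L2v_cinner_integrable[OF v(2,1)]]])
       (use ae in \<open>auto elim: eventually_mono\<close>)
  then show ?thesis by (simp add: wnorm2m_def)
qed

lemma wnorm2m_eq_integral_Re:
  assumes "L2v \<Omega> v" "L2v \<Omega> (\<lambda>x. M x *v v x)"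
  shows "integrable (lebesgue_on \<Omega>) (\<lambda>x. Re (cinner (M x *v v x) (v x)))"
    and "wnorm2m \<Omega> M v = (\<integral>x. Re (cinner (M x *v v x) (v x)) \<partial>lebesgue_on \<Omega>)"
  using L2v_cinner_integrable[OF assms(2,1)] by (simp_all add: wnorm2m_def)

lemma L2v_diff: "L2v \<Omega> v \<Longrightarrow> L2v \<Omega> w \<Longrightarrow> L2v \<Omega> (\<lambda>x. v x - w x)"
  by (simp add: L2v_def L2_diff)

text \<open>The reciprocal weight leaves the mixed term unweighted, in the form that Green's formula
  can cancel.\<close>

lemma weighted_square_expand:
  fixes k :: real
  assumes "k \<noteq> 0"
  shows "inverse k * (cmod (complex_of_real k * e - w))\<^sup>2
    = k * (cmod e)\<^sup>2 - 2 * Re (w * cnj e) + inverse k * (cmod w)\<^sup>2"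
  using assms unfolding cmod_power2 by (simp add: field_simps power2_eq_square)

text \<open>The gradient \<open>g\<close>, the divergence \<open>w\<close> and the residuals
  \<open>r\<close>, \<open>s\<close> are arbitrary representatives. One statement thus serves the
  error, with the residuals of the majorant, and the exact solution, with residuals \<open>f\<close>
  and zero.\<close>

lemma error_identity:
  fixes \<Omega> :: "(real^'n::finite) set"
    and A :: "real^'n \<Rightarrow> complex^'n^'n"
  assumes op: "open \<Omega>"
    and A: "Linf \<Omega> A"
    and A_herm: "AE x in lebesgue_on \<Omega>. \<forall>i j. A x $ i $ j = cnj (A x $ j $ i)"
    and ell: "AE x in lebesgue_on \<Omega>. elliptic \<alpha> (A x)" and \<alpha>: "0 < \<alpha>"
    and b: "Linf \<Omega> b" and d: "Linf \<Omega> d"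
    and div: "weak_div \<Omega> (\<lambda>x. cvec (b x)) (\<lambda>x. complex_of_real (d x))"
    and c: "Linf \<Omega> c"
    and lam: "0 < lam" "AE x in lebesgue_on \<Omega>. lam \<le> c x - d x"
    and e: "H10_pair \<Omega> e g" "weak_grad \<Omega> e g"
    and p: "L2v \<Omega> p" and w: "L2 \<Omega> w" "weak_div \<Omega> p w"
    and r: "AE x in lebesgue_on \<Omega>. complex_of_real (c x - d x) * e x - w x = r x"
    and s: "AE x in lebesgue_on \<Omega>. A x *v g x - (p x + e x *s cvec (b x)) = s x"
  shows "norm2_sq \<Omega> A b c d e p =
     wnorm2 \<Omega> (\<lambda>x. inverse (c x - d x)) r + wnorm2m \<Omega> (\<lambda>x. matrix_inv (A x)) s"
proof -
  let ?M = "lebesgue_on \<Omega>"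
  have \<Omega>: "\<Omega> \<in> sets lebesgue" using op by simp
  define k where "k = (\<lambda>x. c x - d x)"
  define y where "y = (\<lambda>x. p x + e x *s cvec (b x))"
  define z where "z = (\<lambda>x. matrix_inv (A x) *v y x)"
  obtain B where bm: "b \<in> borel_measurable ?M" and B: "AE x in ?M. norm (b x) \<le> B"
    using b by (auto simp: Linf_def)
  obtain D where dm[measurable]: "d \<in> borel_measurable ?M" and D: "AE x in ?M. norm (d x) \<le> D"
    using d by (auto simp: Linf_def)
  obtain C where cm[measurable]: "c \<in> borel_measurable ?M" and C: "AE x in ?M. norm (c x) \<le> C"
    using c by (auto simp: Linf_def)
  have km[measurable]: "k \<in> borel_measurable ?M" unfolding k_def by measurable
  have K: "AE x in ?M. cmod (complex_of_real (k x)) \<le> C + D"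
    using C D by eventually_elim (simp only: norm_of_real, simp add: k_def)
  \<comment> \<open>The uniform bound \<open>lam\<close> makes the reciprocal weight a bounded
    multiplier.\<close>
  have Kinv: "AE x in ?M. cmod (complex_of_real (inverse (k x))) \<le> inverse lam"
    using lam(2)
  proof eventually_elim
    case (elim x)
    then have "lam \<le> k x" by (simp add: k_def)
    with lam(1) show ?case by (simp only: norm_of_real, simp add: le_imp_inverse_le)
  qed
  have cb: "(\<lambda>x. cvec (b x)) \<in> borel_measurable ?M"
    by (rule borel_measurable_continuous_on[OF _ bm]) (auto simp: cvec_def intro!: continuous_intros)
  have norm_cvec: "norm (cvec v) = norm v" for v :: "real^'n"
    by (simp add: cvec_def norm_vec_def L2_set_def)
  have CB: "AE x in ?M. norm (cvec (b x)) \<le> B" using B by (simp add: norm_cvec)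
  have bi: "(\<lambda>x. cvec (b x) $ i) \<in> borel_measurable ?M" for i
    by (rule borel_measurable_continuous_on[OF _ cb]) (intro continuous_intros)
  have Bi: "AE x in ?M. cmod (cvec (b x) $ i) \<le> B" for i
    using CB by eventually_elim (rule order_trans[OF Finite_Cartesian_Product.norm_nth_le])
  have Le: "L2 \<Omega> e" and Lgi: "L2 \<Omega> (\<lambda>x. g x $ i)" for i using H10_pair_L2[OF e(1)] .
  have Lg: "L2v \<Omega> g" using Lgi by (simp add: L2v_def)
  have Lpi: "L2 \<Omega> (\<lambda>x. p x $ i)" for i using p by (simp add: L2v_def)
  have Lbe: "L2 \<Omega> (\<lambda>x. cvec (b x) $ i * e x)" and Lbg: "L2 \<Omega> (\<lambda>x. cvec (b x) $ i * g x $ i)" for i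
    by (intro L2_bounded_mult[OF _ bi Bi] Le Lgi)+
  have Ly: "L2v \<Omega> y" unfolding L2v_def y_def
    using L2_add[OF Lpi Lbe] by (simp add: mult.commute)
  have Lz: "L2v \<Omega> z" unfolding z_def by (rule L2v_matrix_inv[OF \<Omega> A ell \<alpha> Ly])
  have LAg: "L2v \<Omega> (\<lambda>x. A x *v g x)" by (rule L2v_matrix_mult[OF A Lg])
  have Lr: "L2v \<Omega> (\<lambda>x. A x *v g x - y x)" by (rule L2v_diff[OF LAg Ly])
  have Ld: "L2 \<Omega> (\<lambda>x. complex_of_real (d x) * e x)"
    by (rule L2_bounded_mult[OF Le, where C = D]) (use D in auto)
  have Lk: "L2 \<Omega> (\<lambda>x. complex_of_real (k x) * e x)"
    by (rule L2_bounded_mult[OF Le _ K]) auto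
  \<comment> \<open>A weighted square is the real part of a product of two L2 functions,
    \<open>m * v\<close> and the conjugate of \<open>v\<close>.\<close>
  have wint: "integrable ?M (\<lambda>x. m x * (cmod (v x))\<^sup>2)"
    if "m \<in> borel_measurable ?M" "AE x in ?M. cmod (complex_of_real (m x)) \<le> C" "L2 \<Omega> v" for m v C
  proof -
    have "L2 \<Omega> (\<lambda>x. complex_of_real (m x) * v x)"
      by (rule L2_bounded_mult[OF that(3) _ that(2)]) (use that(1) in auto)
    from integrable_Re[OF L2_mult_integrable[OF this L2_cnj[OF that(3)]]]
    show ?thesis by (simp add: mult.assoc complex_norm_square[symmetric])
  qed

  have I1: "integrable ?M (\<lambda>x. c x * (cmod (e x))\<^sup>2)"
    by (rule wint[OF cm _ Le]) (use C in simp)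
  have I4: "integrable ?M (\<lambda>x. inverse (k x) * (cmod (w x))\<^sup>2)"
    by (rule wint[OF _ Kinv w(1)]) measurable
  have J1: "integrable ?M (\<lambda>x. inverse (k x) * (cmod (complex_of_real (k x) * e x - w x))\<^sup>2)"
    by (rule wint[OF _ Kinv L2_diff[OF Lk w(1)]]) measurable
  note I2 = wnorm2m_eq_integral_Re[OF Lg LAg]
  have zx: "matrix_inv (A x) *v y x = z x" for x by (simp add: z_def)
  note I3 = wnorm2m_eq_integral_Re[OF Ly, of "\<lambda>x. matrix_inv (A x)", unfolded zx, OF Lz]
  have J2: "integrable ?M (\<lambda>x. Re (cinner (matrix_inv (A x) *v (A x *v g x - y x)) (A x *v g x - y x)))"
    "wnorm2m \<Omega> (\<lambda>x. matrix_inv (A x)) (\<lambda>x. A x *v g x - y x)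
      = (\<integral>x. Re (cinner (matrix_inv (A x) *v (A x *v g x - y x)) (A x *v g x - y x)) \<partial>?M)"
    by (rule wnorm2m_eq_integral_Re[OF Lr L2v_matrix_inv[OF \<Omega> A ell \<alpha> Lr]])+

  let ?Q1 = "\<lambda>x. w x * cnj (e x)"
    and ?Q2 = "\<lambda>i x. p x $ i * cnj (g x $ i)"
    and ?Q3 = "\<lambda>i x. cvec (b x) $ i * e x * cnj (g x $ i)"
    and ?Q4 = "\<lambda>i x. cvec (b x) $ i * g x $ i * cnj (e x)"
    and ?Q5 = "\<lambda>x. complex_of_real (d x) * e x * cnj (e x)"
  have Qi: "integrable ?M ?Q1" "integrable ?M (?Q2 i)" "integrable ?M (?Q3 i)"
    "integrable ?M (?Q4 i)" "integrable ?M ?Q5" for i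
    by (intro L2_mult_integrable L2_cnj Le Lgi w(1) Lpi Lbe Lbg Ld)+
  \<comment> \<open>\<open>?R\<close> collects the cross terms in two groups: the first integrates
    to zero by Green's formula, the second by the convection identity.\<close>
  let ?R = "\<lambda>x. 2 * (?Q1 x + (\<Sum>i\<in>UNIV. ?Q2 i x)) + ((\<Sum>i\<in>UNIV. ?Q3 i x + ?Q4 i x) + ?Q5 x)"
  have Ri: "integrable ?M ?R" using Qi by simp
  have green: "(\<Sum>i\<in>UNIV. \<integral>x. ?Q2 i x \<partial>?M) = - (\<integral>x. ?Q1 x \<partial>?M)"
    by (rule Green_formula[OF e(1) p w])
  have conv: "(\<Sum>i\<in>UNIV. (\<integral>x. ?Q3 i x \<partial>?M) + (\<integral>x. ?Q4 i x \<partial>?M)) = - (\<integral>x. ?Q5 x \<partial>?M)"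
    by (rule convection_identity[OF e(1) cb CB _ _ div]) (use D in auto)
  have "(\<integral>x. ?R x \<partial>?M) = 2 * ((\<integral>x. ?Q1 x \<partial>?M) + (\<Sum>i\<in>UNIV. \<integral>x. ?Q2 i x \<partial>?M))
      + ((\<Sum>i\<in>UNIV. (\<integral>x. ?Q3 i x \<partial>?M) + (\<integral>x. ?Q4 i x \<partial>?M)) + (\<integral>x. ?Q5 x \<partial>?M))"
    using Qi by simp
  then have R0: "(\<integral>x. Re (?R x) \<partial>?M) = 0"
    using integral_Re[OF Ri] unfolding green conv by simp
  have pw: "AE x in ?M. c x * (cmod (e x))\<^sup>2 + Re (cinner (A x *v g x) (g x)) + Re (cinner (z x) (y x))
        + inverse (k x) * (cmod (w x))\<^sup>2
      = inverse (k x) * (cmod (complex_of_real (k x) * e x - w x))\<^sup>2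
        + Re (cinner (matrix_inv (A x) *v (A x *v g x - y x)) (A x *v g x - y x)) + Re (?R x)"
    using ell A_herm lam(2)
  proof eventually_elim
    case (elim x)
    have inv: "invertible (A x)" by (rule elliptic_invertible[OF elim(1) \<alpha>])
    have "matrix_inv (A x) *v (A x *v g x - y x) = g x - z x"
      by (simp add: matrix_vector_mult_diff_distrib matrix_inv_vector[OF inv] z_def)
    then have r: "Re (cinner (matrix_inv (A x) *v (A x *v g x - y x)) (A x *v g x - y x))
        = Re (cinner (A x *v g x) (g x)) - 2 * Re (cinner (y x) (g x)) + Re (cinner (z x) (y x))"
      using cinner_residual[OF elim(1) \<alpha> elim(2), of "g x" "y x"] by (simp add: z_def)
    have k0: "k x \<noteq> 0" using elim(3) lam(1) by (simp add: k_def)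
    \<comment> \<open>Since \<open>b\<close> is real, \<open>?Q4\<close> is the conjugate of
      \<open>?Q3\<close>. Twice the real part of the convection term can therefore be written as the
      symmetric sum in \<open>convection_identity\<close>.\<close>
    have q34: "Re (?Q4 i x) = Re (?Q3 i x)" for i
      by (simp add: cvec_def)
    have Re_2: "Re (2 * v) = 2 * Re v" for v by simp
    have "cinner (y x) (g x) = (\<Sum>i\<in>UNIV. ?Q2 i x) + (\<Sum>i\<in>UNIV. ?Q3 i x)"
      by (simp add: cinner_def y_def algebra_simps sum.distrib)
    then have "2 * Re (cinner (y x) (g x)) = 2 * (\<Sum>i\<in>UNIV. Re (?Q2 i x)) + (\<Sum>i\<in>UNIV. Re (?Q3 i x) + Re (?Q4 i x))"
      unfolding q34 by (simp add: sum.distrib sum_distrib_left del: times_complex.sel)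
    moreover have "Re (?Q5 x) = d x * (cmod (e x))\<^sup>2"
      by (simp add: mult.assoc complex_norm_square[symmetric])
    ultimately have "Re (?R x) = 2 * Re (?Q1 x) + 2 * Re (cinner (y x) (g x)) + d x * (cmod (e x))\<^sup>2"
      using Re_2 by (simp add: distrib_left del: times_complex.sel)
    \<comment> \<open>The residual square contributes \<open>k x\<close> and \<open>?Q5\<close>
      contributes \<open>d x\<close> as a factor of the squared modulus of \<open>e x\<close>; they
      add up to \<open>c x\<close>, the weight in the error norm.\<close>
    then show ?case
      unfolding r weighted_square_expand[OF k0] by (simp add: k_def algebra_simps)
  qed
  have main: "wnorm2 \<Omega> c e + wnorm2m \<Omega> A g + wnorm2m \<Omega> (\<lambda>x. matrix_inv (A x)) y
      + wnorm2 \<Omega> (\<lambda>x. inverse (k x)) w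
    = wnorm2 \<Omega> (\<lambda>x. inverse (k x)) (\<lambda>x. complex_of_real (k x) * e x - w x)
      + wnorm2m \<Omega> (\<lambda>x. matrix_inv (A x)) (\<lambda>x. A x *v g x - y x)"
  proof -
    let ?L = "\<lambda>x. c x * (cmod (e x))\<^sup>2 + Re (cinner (A x *v g x) (g x)) + Re (cinner (z x) (y x))
        + inverse (k x) * (cmod (w x))\<^sup>2"
    let ?T = "\<lambda>x. inverse (k x) * (cmod (complex_of_real (k x) * e x - w x))\<^sup>2
        + Re (cinner (matrix_inv (A x) *v (A x *v g x - y x)) (A x *v g x - y x)) + Re (?R x)"
    have "wnorm2 \<Omega> c e + wnorm2m \<Omega> A g + wnorm2m \<Omega> (\<lambda>x. matrix_inv (A x)) y
      + wnorm2 \<Omega> (\<lambda>x. inverse (k x)) w = (\<integral>x. ?L x \<partial>?M)"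
      unfolding wnorm2_def I2(2) I3(2)
      using I1 I2(1) I3(1) I4 by simp
    also have "\<dots> = (\<integral>x. ?T x \<partial>?M)"
      by (rule lebesgue_on_integral_AE_cong[OF \<Omega> _ pw])
         (intro borel_measurable_integrable Bochner_Integration.integrable_add I1 I2(1) I3(1) I4)
    also have "\<dots> = wnorm2 \<Omega> (\<lambda>x. inverse (k x)) (\<lambda>x. complex_of_real (k x) * e x - w x)
      + wnorm2m \<Omega> (\<lambda>x. matrix_inv (A x)) (\<lambda>x. A x *v g x - y x) + (\<integral>x. Re (?R x) \<partial>?M)"
      unfolding wnorm2_def J2(2)
      by (subst Bochner_Integration.integral_add[OF Bochner_Integration.integrable_add[OF J1 J2(1)] integrable_Re[OF Ri]],
          subst Bochner_Integration.integral_add[OF J1 J2(1)]) (rule refl)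
    finally show ?thesis unfolding R0 by simp
  qed
  \<comment> \<open>From here on the explicit representatives are exchanged for the ones chosen in
    \<open>norm2_sq\<close>, and the expanded residuals for \<open>r\<close> and
    \<open>s\<close>.\<close>
  have "AE x in ?M. g x = wgrad \<Omega> e x"
    by (rule weak_grad_unique[OF op e(2) weak_grad_wgrad[OF e(2)]])
  then have "wnorm2m \<Omega> A (wgrad \<Omega> e) = wnorm2m \<Omega> A g"
    by (rule wnorm2m_AE_cong[OF \<Omega> Lg LAg, symmetric])
  moreover have "wnorm2 \<Omega> (\<lambda>x. inverse (k x)) (wdiv \<Omega> p) = wnorm2 \<Omega> (\<lambda>x. inverse (k x)) w"
    by (rule wnorm2_AE_cong[OF \<Omega> _ w(1) weak_div_unique[OF op w(2) weak_div_wdiv[OF w(2)]], symmetric])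
       measurable
  moreover have "wnorm2 \<Omega> (\<lambda>x. inverse (k x)) (\<lambda>x. complex_of_real (k x) * e x - w x)
      = wnorm2 \<Omega> (\<lambda>x. inverse (k x)) r"
    by (rule wnorm2_AE_cong[OF \<Omega> _ L2_diff[OF Lk w(1)]]) (measurable, use r in \<open>simp add: k_def\<close>)
  moreover have "wnorm2m \<Omega> (\<lambda>x. matrix_inv (A x)) (\<lambda>x. A x *v g x - y x)
      = wnorm2m \<Omega> (\<lambda>x. matrix_inv (A x)) s"
    by (rule wnorm2m_AE_cong[OF \<Omega> Lr L2v_matrix_inv[OF \<Omega> A ell \<alpha> Lr]]) (use s in \<open>simp add: y_def\<close>)
  ultimately show ?thesis
    using main unfolding norm2_sq_def k_def y_def by simp
qed

theorem theorem3p2: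
  fixes \<Omega> :: "(real^'n::finite) set"
    and A :: "real^'n \<Rightarrow> complex^'n^'n"
    and b :: "real^'n \<Rightarrow> real^'n"
    and divb :: "real^'n \<Rightarrow> real"
    and c :: "real^'n \<Rightarrow> real"
    and f u ut :: "real^'n \<Rightarrow> complex"
    and q qt :: "real^'n \<Rightarrow> complex^'n"
    and \<alpha> \<beta> lam :: real
  assumes "open \<Omega>"
    and A_meas: "Linf \<Omega> A"
    and A_herm: "AE x in lebesgue_on \<Omega>. \<forall>i j. A x $ i $ j = cnj (A x $ j $ i)"
    and \<alpha>_pos: "0 < \<alpha>" and "\<alpha> \<le> \<beta>"
    and A_ell: "\<And>\<phi>. L2v \<Omega> \<phi> \<Longrightarrow>
         \<alpha> * (\<integral>x. (norm (\<phi> x))\<^sup>2 \<partial>lebesgue_on \<Omega>) \<le> wnorm2m \<Omega> A \<phi> \<and>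
         wnorm2m \<Omega> A \<phi> \<le> \<beta> * (\<integral>x. (norm (\<phi> x))\<^sup>2 \<partial>lebesgue_on \<Omega>)"
    and b_Linf: "Linf \<Omega> b"
    and divb_Linf: "Linf \<Omega> divb"
    and divb: "weak_div \<Omega> (\<lambda>x. cvec (b x)) (\<lambda>x. complex_of_real (divb x))"
    and c_Linf: "Linf \<Omega> c"
    and f_L2: "L2 \<Omega> f"
    and c_nonneg: "AE x in lebesgue_on \<Omega>. 0 \<le> c x"
    and lam_pos: "0 < lam"
    and c_divb: "AE x in lebesgue_on \<Omega>. lam \<le> c x - divb x"
    and u: "u \<in> H10 \<Omega>" and q: "q \<in> Hdiv \<Omega>"
    and P2_flux: "AE x in lebesgue_on \<Omega>. q x = A x *v wgrad \<Omega> u x - u x *s cvec (b x)"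
    and P2_eq: "AE x in lebesgue_on \<Omega>.
                  - wdiv \<Omega> q x + complex_of_real (c x - divb x) * u x = f x"
    and ut: "ut \<in> H10 \<Omega>" and qt: "qt \<in> Hdiv \<Omega>"
  shows "norm2_sq \<Omega> A b c divb (\<lambda>x. u x - ut x) (\<lambda>x. q x - qt x) = M2 \<Omega> A b c divb f ut qt
     \<and> (\<not> (AE x in lebesgue_on \<Omega>. f x = 0) \<longrightarrow>
          norm2_sq \<Omega> A b c divb (\<lambda>x. u x - ut x) (\<lambda>x. q x - qt x) / norm2_sq \<Omega> A b c divb u q
          = M2 \<Omega> A b c divb f ut qt / wnorm2 \<Omega> (\<lambda>x. inverse (c x - divb x)) f)"
proof -
  have \<Omega>: "\<Omega> \<in> sets lebesgue" using \<open>open \<Omega>\<close> by simp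
  have ell: "AE x in lebesgue_on \<Omega>. elliptic \<alpha> (A x)"
    by (rule elliptic_pointwise[OF \<Omega> A_meas]) (use A_ell in blast)
  have gu: "H10_pair \<Omega> u (wgrad \<Omega> u)" "weak_grad \<Omega> u (wgrad \<Omega> u)"
    and gut: "H10_pair \<Omega> ut (wgrad \<Omega> ut)" "weak_grad \<Omega> ut (wgrad \<Omega> ut)"
    using H10_imp_pair[OF \<open>open \<Omega>\<close>] H1_wgrad(1)[OF \<open>open \<Omega>\<close>] u ut by (auto simp: H10_def)
  note wq = Hdiv_wdiv[OF \<open>open \<Omega>\<close> q] and wqt = Hdiv_wdiv[OF \<open>open \<Omega>\<close> qt]
  have Lq: "L2v \<Omega> q" "L2v \<Omega> qt" using q qt by (auto simp: Hdiv_def)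
  note identity = error_identity[OF \<open>open \<Omega>\<close> A_meas A_herm ell \<alpha>_pos b_Linf divb_Linf divb c_Linf lam_pos c_divb]
  \<comment> \<open>Differences of the chosen derivatives are supplied as representatives for the
    error; they need not coincide pointwise with the derivatives chosen for the error
    itself.\<close>
  have error: "norm2_sq \<Omega> A b c divb (\<lambda>x. u x - ut x) (\<lambda>x. q x - qt x) = M2 \<Omega> A b c divb f ut qt"
    unfolding M2_def
  proof (rule identity[OF H10_pair_diff[OF gu(1) gut(1)] weak_grad_diff[OF gu(2) gut(2)] L2v_diff[OF Lq]
        L2_diff[OF wq(2) wqt(2)] weak_div_diff[OF wq(1) wqt(1)]])
    show "AE x in lebesgue_on \<Omega>. complex_of_real (c x - divb x) * (u x - ut x) - (wdiv \<Omega> q x - wdiv \<Omega> qt x)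
        = f x - complex_of_real (c x - divb x) * ut x + wdiv \<Omega> qt x"
      using P2_eq by eventually_elim (simp add: algebra_simps)
    show "AE x in lebesgue_on \<Omega>. A x *v (wgrad \<Omega> u x - wgrad \<Omega> ut x)
          - (q x - qt x + (u x - ut x) *s cvec (b x))
        = qt x - A x *v wgrad \<Omega> ut x + ut x *s cvec (b x)"
      using P2_flux by eventually_elim
        (simp add: matrix_vector_mult_diff_distrib vector_sub_rdistrib)
  qed
  have "norm2_sq \<Omega> A b c divb u q = wnorm2 \<Omega> (\<lambda>x. inverse (c x - divb x)) f
      + wnorm2m \<Omega> (\<lambda>x. matrix_inv (A x)) (\<lambda>x. 0)"
  proof (rule identity[OF gu Lq(1) wq(2,1)])
    show "AE x in lebesgue_on \<Omega>. complex_of_real (c x - divb x) * u x - wdiv \<Omega> q x = f x"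
      using P2_eq by eventually_elim simp
    show "AE x in lebesgue_on \<Omega>. A x *v wgrad \<Omega> u x - (q x + u x *s cvec (b x)) = 0"
      using P2_flux by eventually_elim simp
  qed
  then have "norm2_sq \<Omega> A b c divb u q = wnorm2 \<Omega> (\<lambda>x. inverse (c x - divb x)) f"
    by (simp add: wnorm2m_def cinner_def)
  with error show ?thesis by simp
qed

end
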